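(* Let $T$ be a complex $2$-torus and let $E\subset T$ be finite. Then there exist an open set $U\subset T$ containing $E$ and a dominating map from $\mathbb{C}^2$ into the complement of $U$, i.e. a holomorphic map $F:\mathbb{C}^2\to T$ with $F(\mathbb{C}^2)\subseteq T\setminus U$ whose Jacobian determinant is not identically zero.
   Context: A complex $2$-torus is a quotient $\mathbb{C}^2/\Lambda$ of $\mathbb{C}^2$ by a lattice $\Lambda$ of real rank $4$. *)

theory Defs
  imports "HOL-Analysis.Analysis"
begin

text \<open>The ambient space is \<open>complex^2\<close>. It is a real vector space of dimension 4, so
  \<^const>\<open>independent\<close> below means linear independence over the reals.\<close>

definition lattice_rank4 :: "(complex^2) set \<Rightarrow> bool" where
  "lattice_rank4 \<Lambda> \<longleftrightarrow>
     (\<exists>B. independent B \<and> card B = 4 \<and>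
          \<Lambda> = range (\<lambda>k :: complex^2 \<Rightarrow> int. \<Sum>b\<in>B. of_int (k b) *\<^sub>R b))"

definition lattice_rel :: "(complex^2) set \<Rightarrow> (complex^2) rel" where
  "lattice_rel \<Lambda> = {(z, w). z - w \<in> \<Lambda>}"

definition torus_proj :: "(complex^2) set \<Rightarrow> complex^2 \<Rightarrow> (complex^2) set" where
  "torus_proj \<Lambda> z = lattice_rel \<Lambda> `` {z}"

definition torus :: "(complex^2) set \<Rightarrow> (complex^2) set topology" where
  "torus \<Lambda> = topology (\<lambda>U. U \<subseteq> UNIV // lattice_rel \<Lambda> \<and> open (torus_proj \<Lambda> -` U))"

lemma openin_torus:
  "openin (torus \<Lambda>) U \<longleftrightarrow> U \<subseteq> UNIV // lattice_rel \<Lambda> \<and> open (torus_proj \<Lambda> -` U)"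
proof -
  have "istopology (\<lambda>U. U \<subseteq> UNIV // lattice_rel \<Lambda> \<and> open (torus_proj \<Lambda> -` U))"
    unfolding istopology_def by (auto simp: vimage_Union)
  then show ?thesis
    unfolding torus_def by (simp add: topology_inverse')
qed

lemma topspace_torus: "topspace (torus \<Lambda>) = UNIV // lattice_rel \<Lambda>"
proof (rule antisym)
  show "topspace (torus \<Lambda>) \<subseteq> UNIV // lattice_rel \<Lambda>"
    using openin_topspace openin_torus by blast
  have "torus_proj \<Lambda> -` (UNIV // lattice_rel \<Lambda>) = UNIV"
    by (auto simp: torus_proj_def quotient_def)
  then show "UNIV // lattice_rel \<Lambda> \<subseteq> topspace (torus \<Lambda>)"
    by (intro openin_subset) (simp add: openin_torus)
qed

lemma quotient_map_torus_proj: "quotient_map euclidean (torus \<Lambda>) (torus_proj \<Lambda>)"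
  unfolding quotient_map_def
  by (auto simp: topspace_torus openin_torus torus_proj_def quotient_def vimage_def)

definition holomorphic_map_on :: "(complex^'n \<Rightarrow> complex^'m) \<Rightarrow> (complex^'n) set \<Rightarrow> bool" where
  "holomorphic_map_on f S \<longleftrightarrow> open S \<and>
     (\<forall>z\<in>S. \<exists>L. Vector_Spaces.linear (*s) (*s) L \<and> (f has_derivative L) (at z))"

text \<open>On a complex linear derivative, \<^const>\<open>matrix\<close> (at type \<open>complex\<close>) gives the matrix of
  complex partial derivatives, so the determinant is the complex Jacobian determinant.\<close>

definition complex_jacobian_det :: "(complex^'n \<Rightarrow> complex^'n) \<Rightarrow> complex^'n \<Rightarrow> complex" where
  "complex_jacobian_det f z = det (matrix (frechet_derivative f (at z)))"

text \<open>The complex structure on the torus is given by the charts \<open>(\<pi>|V)\<inverse> : \<pi> ` V \<rightarrow> V\<close>, where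
  \<open>V\<close> ranges over the open sets on which the projection \<open>\<pi>\<close> is injective.\<close>

definition chart_domain :: "(complex^2) set \<Rightarrow> (complex^2) set \<Rightarrow> bool" where
  "chart_domain \<Lambda> V \<longleftrightarrow> open V \<and> inj_on (torus_proj \<Lambda>) V"

definition torus_chart :: "(complex^2) set \<Rightarrow> (complex^2) set \<Rightarrow> (complex^2) set \<Rightarrow> complex^2" where
  "torus_chart \<Lambda> V = inv_into V (torus_proj \<Lambda>)"

definition torus_holomorphic :: "(complex^2) set \<Rightarrow> (complex^2 \<Rightarrow> (complex^2) set) \<Rightarrow> bool" where
  "torus_holomorphic \<Lambda> F \<longleftrightarrow>
     continuous_map euclidean (torus \<Lambda>) F \<and>
     (\<forall>V. chart_domain \<Lambda> V \<longrightarrow>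
        holomorphic_map_on (torus_chart \<Lambda> V \<circ> F) (F -` (torus_proj \<Lambda> ` V)))"

text \<open>Transition maps between charts are locally translations by elements of \<open>\<Lambda>\<close>, so the Jacobian
  determinant of \<open>F\<close> at \<open>z\<close> does not depend on the chart used around \<open>F z\<close>.\<close>

definition torus_dominating :: "(complex^2) set \<Rightarrow> (complex^2 \<Rightarrow> (complex^2) set) \<Rightarrow> bool" where
  "torus_dominating \<Lambda> F \<longleftrightarrow>
     torus_holomorphic \<Lambda> F \<and>
     (\<exists>z V. chart_domain \<Lambda> V \<and> F z \<in> torus_proj \<Lambda> ` V \<and>
            complex_jacobian_det (torus_chart \<Lambda> V \<circ> F) z \<noteq> 0)"

end

theory Submission
  imports Defs "HOL-Complex_Analysis.Cauchy_Integral_Theorem" "HOL-Real_Asymp.Real_Asymp"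
begin

text \<open>
  Each real coordinate functional of \<open>\<Lambda>\<close> is the real part of a complex linear functional, and two of
  these, \<open>l1\<close> and \<open>l2\<close>, are independent. They map \<open>\<Lambda>\<close> into \<open>(\<int> + \<i>\<real>)\<^sup>2\<close>, and by Dirichlet's theorem some
  multiple \<open>q\<close> brings \<open>E\<close> close to \<open>(\<int> + \<i>\<real>)\<^sup>2\<close> as well. It remains to find a nondegenerate entire map
  of \<open>\<complex>\<^sup>2\<close> whose image avoids the points \<open>(z, w)\<close> with \<open>(Re z, Re w)\<close> near a (sparse) lattice in \<open>\<real>\<^sup>2\<close>.

  This map is a limit of compositions of shears \<open>(z, w) \<mapsto> (z, w + m f z)\<close> and their transposes, where \<open>f\<close>
  is close to 1 on the strip \<open>Re z \<approx> k\<close> and close to 0 on the strips around all other integers and on a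
  large disc. On the forbidden set such a shear acts by sliding a single column of a subset of
  \<open>\<int>\<^sup>2\<close>, while it is nearly the identity on a large ball. Sliding far away rows makes a long gap
  in a given column, and sliding this column moves the gap to the centre; repeating this pushes the
  forbidden set out of every ball.
\<close>

section \<open>Entire functions concentrated on one vertical strip\<close>

text \<open>On the strips around the half-integers the cosine makes this function tiny, as its real part is
  at most \<open>- cosh (2 * pi * Im s) / 2\<close> there. On the real axis it peaks at the integers, and the Gaussian
  factor makes the peak at 0 dominate the others.\<close>

definition peak :: "real \<Rightarrow> complex \<Rightarrow> complex" where
  "peak L s = exp (of_real L * (4 * cos (2 * of_real pi * s) - s\<^sup>2))"

lemma norm_peak:
  "norm (peak L s) =
     exp (L * (4 * (cos (2 * pi * Re s) * cosh (2 * pi * Im s)) - (Re s)\<^sup>2 + (Im s)\<^sup>2))"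
  by (simp add: peak_def Re_cos cosh_field_def power2_eq_square algebra_simps)

text \<open>Half the sum of \<open>exp t \<ge> 1 + t + t^2/2\<close> and
  \<open>exp (-t) \<ge> 1 - t\<close>. The constant 1/4 suffices because \<open>pi^2 > 9\<close>
  leaves ample room in the estimate of the peak.\<close>

lemma cosh_ge_one_plus_quarter_square: "1 + t\<^sup>2 / 4 \<le> cosh (t::real)"
proof -
  have "1 + t\<^sup>2 / 4 \<le> cosh t" if "t \<ge> 0" for t :: real
    using exp_lower_Taylor_quadratic[OF that] exp_ge_add_one_self[of "-t"]
    by (simp add: cosh_field_def)
  from this[of "\<bar>t\<bar>"] show ?thesis by simp
qed

lemma cosh_two_pi_ge: "1 + 9 * y\<^sup>2 \<le> cosh (2 * pi * y)"
proof -
  have "9 * y\<^sup>2 \<le> pi\<^sup>2 * y\<^sup>2"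
    using pi_gt3 power_mono[of 3 pi 2] by (intro mult_right_mono) auto
  then show ?thesis
    using cosh_ge_one_plus_quarter_square[of "2 * pi * y"] by (simp add: power_mult_distrib)
qed

text \<open>Here \<open>2 * pi * Re s\<close> is within pi/4 < pi/3 of an odd multiple of pi, so the
  cosine is at most -1/2 and the growth of cosh beats the term \<open>(Im s)^2\<close>. The crude
  bound \<open>1 / (1 + y^2)\<close> is chosen because it integrates to arctan along vertical
  lines.\<close>

lemma norm_peak_half_integer_strip:
  assumes "1 \<le> L" "\<bar>Re s - (of_int n + 1/2)\<bar> \<le> 1/8"
  shows "norm (peak L s) \<le> 1 / (1 + (Im s)\<^sup>2)"
proof -
  define u where "u = Re s - (of_int n + 1/2)"
  have "2 * pi * Re s = 2 * pi * u + pi + 2 * pi * of_int n"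
    by (simp add: u_def algebra_simps)
  then have "cos (2 * pi * Re s) = - cos (2 * pi * u)"
    using cos_periodic_pi cos_int_2pin[of n] sin_int_2pin[of n] by (simp add: cos_add)
  also have "cos (2 * pi * u) = cos \<bar>2 * pi * u\<bar>" by simp
  finally have *: "cos (2 * pi * Re s) = - cos \<bar>2 * pi * u\<bar>" .
  have "\<bar>u\<bar> \<le> 1/8" using assms by (simp add: u_def)
  then have "\<bar>2 * pi * u\<bar> \<le> pi / 3"
    using mult_left_mono[of "\<bar>u\<bar>" "1/8" pi] by (simp add: abs_mult)
  then have "cos (pi / 3) \<le> cos \<bar>2 * pi * u\<bar>"
    by (intro cos_monotone_0_pi_le) auto
  then have "cos (2 * pi * Re s) \<le> - (1/2)" using * by (simp add: cos_60)
  then have "cos (2 * pi * Re s) * cosh (2 * pi * Im s) \<le> - (1/2) * cosh (2 * pi * Im s)"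
    by (intro mult_right_mono) auto
  also have "\<dots> \<le> - (1/2) * (1 + 9 * (Im s)\<^sup>2)"
    using cosh_two_pi_ge[of "Im s"] by simp
  finally have *: "cos (2 * pi * Re s) * cosh (2 * pi * Im s) \<le> - (1/2) * (1 + 9 * (Im s)\<^sup>2)" .
  have "4 * (cos (2 * pi * Re s) * cosh (2 * pi * Im s)) \<le> - 2 - 18 * (Im s)\<^sup>2"
    using mult_left_mono[OF *, of 4] by (simp add: distrib_left)
  then have "4 * (cos (2 * pi * Re s) * cosh (2 * pi * Im s)) - (Re s)\<^sup>2 + (Im s)\<^sup>2 \<le> - (Im s)\<^sup>2"
    using zero_le_power2[of "Re s"] zero_le_power2[of "Im s"] by linarith
  then have "L * (4 * (cos (2 * pi * Re s) * cosh (2 * pi * Im s)) - (Re s)\<^sup>2 + (Im s)\<^sup>2)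
      \<le> L * - (Im s)\<^sup>2"
    using assms by (intro mult_left_mono) auto
  also have "\<dots> \<le> - (Im s)\<^sup>2"
    using assms mult_right_mono[of 1 L "(Im s)\<^sup>2"] by simp
  finally have "norm (peak L s) \<le> inverse (exp ((Im s)\<^sup>2))"
    by (simp add: norm_peak flip: exp_minus)
  also have "\<dots> \<le> inverse (1 + (Im s)\<^sup>2)"
    by (intro le_imp_inverse_le exp_ge_add_one_self) (simp add: add_pos_nonneg)
  finally show ?thesis by (simp add: inverse_eq_divide)
qed


lemma peak_has_primitive:
  obtains P where "\<And>z. (P has_field_derivative peak L z) (at z)"
proof -
  have "peak L holomorphic_on UNIV"
    unfolding peak_def by (intro holomorphic_intros)
  then have "peak L field_differentiable at z" for z
    by (simp add: holomorphic_on_def)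
  moreover have "continuous_on UNIV (peak L)"
    unfolding peak_def by (intro continuous_intros)
  ultimately obtain P where
    "\<And>z. z \<in> UNIV \<Longrightarrow> (P has_field_derivative peak L z) (at z within UNIV)"
    using holomorphic_convex_primitive[of UNIV "{}" "peak L"] by blast
  then show ?thesis using that by auto
qed

lemma peak_of_real: "peak L (of_real x) = of_real (exp (L * (4 * cos (2 * pi * x) - x\<^sup>2)))"
proof -
  have "cos (2 * of_real pi * of_real x) = (of_real (cos (2 * pi * x)) :: complex)"
    by (metis cos_of_real of_real_mult of_real_numeral)
  then show ?thesis by (simp add: peak_def exp_of_real[symmetric])
qed

section \<open>The integral of the peak over a sliding unit segment\<close>

locale peak_primitive =
  fixes L :: real and P :: "complex \<Rightarrow> complex"
  assumes L: "1 \<le> L" and P: "\<And>z. (P has_field_derivative peak L z) (at z)"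
begin

definition total :: complex where "total = P (1/2) - P (-1/2)"

text \<open>The integral of \<open>peak L\<close> over the unit segment centred at z, divided by the
  one centred at 0. Its derivative involves only the two endpoints, which lie near half-integers
  when z is near an integer; there the peak is at most 1 while \<open>total\<close> is exponentially
  large in L.\<close>

definition bump :: "complex \<Rightarrow> complex" where
  "bump z = (P (z + 1/2) - P (z - 1/2)) / total"

definition bump' :: "complex \<Rightarrow> complex" where
  "bump' z = (peak L (z + 1/2) - peak L (z - 1/2)) / total"

lemma bump_has_field_derivative: "(bump has_field_derivative bump' z) (at z)"
  unfolding bump_def bump'_def
  by (rule DERIV_cdivide) (auto intro!: derivative_eq_intros DERIV_chain2[OF P])

lemma Re_P_has_real_derivative:
  "((\<lambda>t. Re (P (of_real t))) has_real_derivative exp (L * (4 * cos (2 * pi * t) - t\<^sup>2))) (at t)"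
proof -
  have "((\<lambda>t. P (of_real t)) has_vector_derivative peak L (of_real t)) (at t)"
    using has_vector_derivative_real_field[OF P] by simp
  from bounded_linear.has_vector_derivative[OF bounded_linear_Re this] show ?thesis
    by (simp add: peak_of_real has_real_derivative_iff_has_vector_derivative)
qed

lemma Re_P_mono: "s \<le> t \<Longrightarrow> Re (P (of_real s)) \<le> Re (P (of_real t))"
  by (rule DERIV_nonneg_imp_nondecreasing) (use Re_P_has_real_derivative in force)+

text \<open>On the real axis the integrand is positive, and on [-1/8, 1/8], an interval of length
  1/4, its exponent is at least \<open>L * (4 * (1/2) - 1) = L\<close>.\<close>

lemma Re_total_ge: "exp L / 4 \<le> Re total"
proof -
  obtain t :: real where t: "-1/8 < t" "t < 1/8" "Re (P (of_real (1/8))) - Re (P (of_real (-1/8))) =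
      (1/8 - (-1/8)) * exp (L * (4 * cos (2 * pi * t) - t\<^sup>2))"
    using MVT2[of "-1/8" "1/8" "\<lambda>t. Re (P (of_real t))", OF _ Re_P_has_real_derivative] by auto
  have "\<bar>2 * pi * t\<bar> \<le> pi / 3"
    using mult_left_mono[of "\<bar>t\<bar>" "1/8" pi] t(1,2) by (simp add: abs_mult)
  then have "cos (pi / 3) \<le> cos \<bar>2 * pi * t\<bar>"
    by (intro cos_monotone_0_pi_le) auto
  then have "1/2 \<le> cos (2 * pi * t)" by (simp add: cos_60)
  moreover have "t\<^sup>2 \<le> 1" using t(1,2) by (simp add: abs_square_le_1)
  ultimately have "L * 1 \<le> L * (4 * cos (2 * pi * t) - t\<^sup>2)"
    using L by (intro mult_left_mono) auto
  then have "exp L / 4 \<le> Re (P (of_real (1/8))) - Re (P (of_real (-1/8)))"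
    using t(3) by simp
  also have "\<dots> \<le> Re (P (of_real (1/2))) - Re (P (of_real (-1/2)))"
    using Re_P_mono[of "1/8" "1/2"] Re_P_mono[of "-1/2" "-1/8"] by simp
  finally show ?thesis by (simp add: total_def)
qed

lemma norm_total_ge: "exp L / 4 \<le> norm total"
  by (rule order_trans[OF Re_total_ge complex_Re_le_cmod])

lemma total_nonzero: "total \<noteq> 0"
proof
  assume "total = 0"
  then have "exp L / 4 \<le> 0" using norm_total_ge by simp
  then show False using exp_gt_zero[of L] by linarith
qed

text \<open>The integrand is real on the real axis. Hence \<open>norm total\<close> is the exact
  integral, against which the integrals around other integers can be compared.\<close>

lemma Im_total: "Im total = 0"
proof -
  have "((\<lambda>t. P (of_real t)) has_vector_derivative peak L (of_real t)) (at t)" for t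
    using has_vector_derivative_real_field[OF P] by simp
  from bounded_linear.has_vector_derivative[OF bounded_linear_Im this]
  have "((\<lambda>t. Im (P (of_real t))) has_real_derivative 0) (at t)" for t
    by (simp add: peak_of_real has_real_derivative_iff_has_vector_derivative)
  then have "Im (P (of_real (1/2))) = Im (P (of_real (-1/2)))"
    using DERIV_isconst_all[of "\<lambda>t. Im (P (of_real t))"] by blast
  then show ?thesis by (simp add: total_def)
qed

lemma norm_total: "norm total = Re total"
proof -
  have "0 \<le> Re total" by (rule order_trans[OF _ Re_total_ge]) simp
  then show ?thesis by (simp add: cmod_eq_Re Im_total)
qed

lemma bump_0: "bump 0 = 1"
  using total_nonzero by (simp add: bump_def total_def)

text \<open>The integrals over the segments centred at j and at 0 are compared pointwise: a shift by
  j preserves the cosine, and only the Gaussian factor changes.\<close>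

lemma norm_bump_int:
  assumes "j \<noteq> 0"
  shows "norm (bump (of_int j)) \<le> exp (- L / 2) + 4 * exp (- L)"
proof -
  have pt: "exp (L * (4 * cos (2 * pi * (of_int j + t)) - (of_int j + t)\<^sup>2))
      \<le> exp (- L / 2) * exp (L * (4 * cos (2 * pi * t) - t\<^sup>2)) + 1" (is "?l \<le> ?r")
    if t: "\<bar>t\<bar> \<le> 1/2" for t :: real
  proof -
    have c: "cos (2 * pi * (of_int j + t)) = cos (2 * pi * t)"
      unfolding distrib_left cos_add by (simp only: cos_int_2pin sin_int_2pin)
    show ?thesis
    \<comment> \<open>Shifting by j increases the square by at least 1/2 only away from the ends of
      the segment; at \<open>\<bar>t\<bar> = 1/2\<close> the shifted point can have the same modulus
      as t. Towards the ends the cosine is nonpositive instead, so the peak is at most 1.\<close>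
    proof (cases "\<bar>t\<bar> \<le> 1/4")
      case True
      have "1 / 2 \<le> \<bar>of_int j :: real\<bar> * (\<bar>of_int j\<bar> - 2 * \<bar>t\<bar>)"
        using mult_mono[of 1 "\<bar>of_int j :: real\<bar>" "1/2" "\<bar>of_int j\<bar> - 2 * \<bar>t\<bar>"] True assms
        by (simp add: flip: of_int_abs)
      also have "\<dots> \<le> (of_int j)\<^sup>2 + 2 * of_int j * t"
        using abs_ge_minus_self[of "2 * of_int j * t"]
        by (simp add: right_diff_distrib abs_mult power2_eq_square)
      finally have "L * (4 * cos (2 * pi * (of_int j + t)) - (of_int j + t)\<^sup>2)
          \<le> L * (- 1/2 + (4 * cos (2 * pi * t) - t\<^sup>2))"
        using L unfolding c by (intro mult_left_mono) (auto simp: power2_sum)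
      then have "?l \<le> exp (L * (- 1/2 + (4 * cos (2 * pi * t) - t\<^sup>2)))" by simp
      also have "\<dots> = exp (- L / 2) * exp (L * (4 * cos (2 * pi * t) - t\<^sup>2))"
        by (simp add: algebra_simps flip: exp_add)
      finally show ?thesis by simp
    next
      case False
      have "cos (2 * pi * t) = cos \<bar>2 * pi * t\<bar>" by simp
      also have "\<dots> \<le> cos (pi / 2)"
      proof (rule cos_monotone_0_pi_le)
        show "pi / 2 \<le> \<bar>2 * pi * t\<bar>" "\<bar>2 * pi * t\<bar> \<le> pi"
          using False t mult_left_mono[of "1/4" "\<bar>t\<bar>" pi] mult_left_mono[of "\<bar>t\<bar>" "1/2" pi]
          by (simp_all add: abs_mult)
      qed simp
      finally have "cos (2 * pi * t) \<le> 0" by simp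
      then have "4 * cos (2 * pi * (of_int j + t)) - (of_int j + t)\<^sup>2 \<le> 0"
        unfolding c using zero_le_power2[of "of_int j + t"] by linarith
      then have "?l \<le> 1" using L by (simp add: mult_nonneg_nonpos)
      moreover have "0 \<le> exp (- L / 2) * exp (L * (4 * cos (2 * pi * t) - t\<^sup>2))" by simp
      ultimately show ?thesis by linarith
    qed
  qed
  \<comment> \<open>A primitive of the majorant in \<open>pt\<close>. Its increment over [-1/2, 1/2]
    is \<open>exp (- L / 2) * norm total + 1\<close>.\<close>
  define \<phi> where "\<phi> t = exp (- L / 2) * Re (P (of_real t)) + t" for t :: real
  have *: "((\<lambda>t. P (of_int j + of_real t)) has_vector_derivative peak L (of_int j + of_real t)) (at t)" for t
  proof (rule has_vector_derivative_real_field)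
    show "((\<lambda>a. P (of_int j + a)) has_field_derivative peak L (of_int j + of_real t)) (at (of_real t))"
    proof -
      have "((\<lambda>a. of_int j + a) has_field_derivative 1) (at (complex_of_real t))"
        by (auto intro!: derivative_eq_intros)
      from DERIV_chain2[OF P this] show ?thesis by simp
    qed
  qed
  have **: "(\<phi> has_vector_derivative exp (- L / 2) * exp (L * (4 * cos (2 * pi * t) - t\<^sup>2)) + 1) (at t)" for t
    unfolding \<phi>_def has_real_derivative_iff_has_vector_derivative[symmetric]
    by (rule DERIV_add[OF DERIV_cmult[OF Re_P_has_real_derivative] DERIV_ident])
  have "norm (P (of_int j + of_real (1/2)) - P (of_int j + of_real (-1/2))) \<le> \<phi> (1/2) - \<phi> (-1/2)"
  proof (rule differentiable_bound_general[where f="\<lambda>t. P (of_int j + of_real t)", OF _ _ _ * **])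
    show "continuous_on {-1/2..1/2} (\<lambda>t. P (of_int j + of_real t))"
      by (intro continuous_at_imp_continuous_on ballI has_vector_derivative_continuous[OF *])
    show "continuous_on {-1/2..1/2} \<phi>"
      by (intro continuous_at_imp_continuous_on ballI has_vector_derivative_continuous[OF **])
    show "norm (peak L (of_int j + of_real t)) \<le> exp (- L / 2) * exp (L * (4 * cos (2 * pi * t) - t\<^sup>2)) + 1"
      if "-1/2 < t" "t < 1/2" for t
      using pt[of t] that peak_of_real[of L "of_int j + t"] by simp
  qed simp
  also have "\<dots> = exp (- L / 2) * norm total + 1"
    unfolding norm_total by (simp add: \<phi>_def total_def algebra_simps)
  finally have "norm (bump (of_int j)) \<le> (exp (- L / 2) * norm total + 1) / norm total"
    unfolding bump_def norm_divide by (intro divide_right_mono) (simp_all add: add.commute)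
  also have "\<dots> = exp (- L / 2) + 1 / norm total"
    using total_nonzero by (simp add: field_simps)
  also have "1 / norm total \<le> 1 / (exp L / 4)"
    using norm_total_ge by (intro divide_left_mono) (auto simp: total_nonzero)
  finally show ?thesis by (simp add: exp_minus field_simps)
qed

lemma norm_bump'_le:
  assumes "norm (peak L (z + 1/2)) \<le> B" "norm (peak L (z - 1/2)) \<le> B"
  shows "norm (bump' z) \<le> 8 * exp (- L) * B"
proof -
  have "norm (bump' z) \<le> (2 * B) / norm total"
    unfolding bump'_def norm_divide
    by (intro divide_right_mono norm_triangle_le_diff) (use assms in auto)
  also have "\<dots> \<le> (2 * B) / (exp L / 4)"
    using norm_total_ge assms norm_ge_zero[of "peak L (z + 1/2)"]
    by (intro divide_left_mono) (auto simp: total_nonzero simp del: norm_ge_zero)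
  finally show ?thesis by (simp add: exp_minus field_simps)
qed

lemma norm_bump'_strip:
  assumes "\<bar>Re z - of_int j\<bar> \<le> 1/8"
  shows "norm (bump' z) \<le> 8 * exp (- L) * (1 / (1 + (Im z)\<^sup>2))"
  using norm_peak_half_integer_strip[OF L, of "z + 1/2" j]
    norm_peak_half_integer_strip[OF L, of "z - 1/2" "j - 1"] assms
  by (intro norm_bump'_le) auto

text \<open>Move horizontally from j to \<open>Re z\<close>, then vertically to z. The first move
  costs at most \<open>8 * exp (- L)\<close>. On the second the derivative is at most
  \<open>8 * exp (- L) / (1 + t^2)\<close>, whose integral is below \<open>16 * exp (- L)\<close> at
  every height because arctan is bounded by pi/2 < 2.\<close>

lemma bump_strip:
  assumes z: "\<bar>Re z - of_int j\<bar> \<le> 1/8"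
  shows "norm (bump z - bump (of_int j)) \<le> 24 * exp (- L)"
proof -
  have "norm (bump (of_real (Re z)) - bump (of_real (of_int j)))
      \<le> 8 * exp (- L) * norm (of_real (Re z) - of_real (of_int j) :: complex)"
  proof (rule field_differentiable_bound[where S="{s. \<bar>Re s - of_int j\<bar> \<le> 1/8}"])
    have "{s. \<bar>Re s - of_int j\<bar> \<le> 1/8} = {s. Re s \<le> of_int j + 1/8} \<inter> {s. Re s \<ge> of_int j - 1/8}"
      unfolding abs_diff_le_iff by auto
    then show "convex {s. \<bar>Re s - of_int j\<bar> \<le> 1/8}"
      by (simp add: convex_Int convex_halfspace_Re_le convex_halfspace_Re_ge)
    show "norm (bump' s) \<le> 8 * exp (- L)" if "s \<in> {s. \<bar>Re s - of_int j\<bar> \<le> 1/8}" for s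
    proof -
      have "norm (bump' s) \<le> 8 * exp (- L) * (1 / (1 + (Im s)\<^sup>2))"
        using that by (intro norm_bump'_strip[of s j]) auto
      also have "\<dots> \<le> 8 * exp (- L) * 1"
        by (intro mult_left_mono) (auto simp: divide_le_eq add_pos_nonneg)
      finally show ?thesis by simp
    qed
  qed (use z in \<open>auto intro: has_field_derivative_at_within bump_has_field_derivative\<close>)
  also have "\<dots> = 8 * exp (- L) * \<bar>Re z - of_int j\<bar>"
    by (metis norm_of_real of_real_diff)
  also have "\<dots> \<le> 8 * exp (- L) * 1" using z by (intro mult_left_mono) auto
  finally have h: "norm (bump (of_real (Re z)) - bump (of_int j)) \<le> 8 * exp (- L)" by simp
  \<comment> \<open>The sign of \<open>Im z\<close>: both half-planes are treated by one path with
    parameter running from 0 to \<open>\<bar>Im z\<bar>\<close>.\<close>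
  define \<sigma> :: real where "\<sigma> = (if Im z < 0 then -1 else 1)"
  have \<sigma>: "\<sigma>\<^sup>2 = 1" "\<sigma> * \<bar>Im z\<bar> = Im z" "norm (complex_of_real \<sigma>) = 1" by (auto simp: \<sigma>_def)
  define p where "p t = of_real (Re z) + t *\<^sub>R (\<i> * of_real \<sigma>)" for t
  have *: "((\<lambda>t. bump (p t)) has_vector_derivative (\<i> * of_real \<sigma> * bump' (p t))) (at t)" for t
  proof -
    have "(p has_vector_derivative \<i> * of_real \<sigma>) (at t)"
      unfolding p_def has_vector_derivative_def by (auto intro!: derivative_eq_intros)
    from field_vector_diff_chain_at[OF this bump_has_field_derivative] show ?thesis
      by (simp add: o_def)
  qed
  have **: "((\<lambda>t. 8 * exp (- L) * arctan t) has_vector_derivative 8 * exp (- L) * (1 / (1 + t\<^sup>2))) (at t)" for t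
    unfolding has_real_derivative_iff_has_vector_derivative[symmetric]
    by (auto intro!: derivative_eq_intros simp: field_simps)
  have v: "norm (bump (p \<bar>Im z\<bar>) - bump (p 0)) \<le> 8 * exp (- L) * 2"
  proof (cases "Im z = 0")
    case False
    have "norm (bump (p \<bar>Im z\<bar>) - bump (p 0)) \<le> 8 * exp (- L) * arctan \<bar>Im z\<bar> - 8 * exp (- L) * arctan 0"
    proof (rule differentiable_bound_general[OF _ _ _ * **])
      show "continuous_on {0..\<bar>Im z\<bar>} (\<lambda>t. bump (p t))"
        by (intro continuous_at_imp_continuous_on ballI has_vector_derivative_continuous[OF *])
      show "continuous_on {0..\<bar>Im z\<bar>} (\<lambda>t. 8 * exp (- L) * arctan t)"
        by (intro continuous_intros)
      show "norm (\<i> * of_real \<sigma> * bump' (p t)) \<le> 8 * exp (- L) * (1 / (1 + t\<^sup>2))" for t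
        using norm_bump'_strip[of "p t" j] z \<sigma> by (simp add: norm_mult p_def power_mult_distrib)
    qed (use False in auto)
    also have "\<dots> \<le> 8 * exp (- L) * 2"
      using arctan_ubound[of "\<bar>Im z\<bar>"] pi_less_4 by simp
    finally show ?thesis .
  qed (simp add: p_def)
  have "p \<bar>Im z\<bar> = z" "p 0 = of_real (Re z)"
    using \<sigma> by (simp_all add: p_def complex_eq_iff mult.commute)
  with h v show ?thesis
    using norm_triangle_ineq[of "bump z - bump (of_real (Re z))" "bump (of_real (Re z)) - bump (of_int j)"] by simp
qed

text \<open>The Gaussian outweighs the cosine on the whole unit segment around z, so the peak is at
  most 1 there. Dividing by \<open>total\<close> makes both the value and the derivative
  exponentially small.\<close>

lemma bump_far:
  assumes "4 * cosh (2 * pi * r) + r\<^sup>2 \<le> (\<bar>Re z\<bar> - 1/2)\<^sup>2" "\<bar>Im z\<bar> \<le> r" "1/2 \<le> \<bar>Re z\<bar>"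
  shows "norm (bump z) \<le> 4 * exp (- L)" "norm (bump' z) \<le> 8 * exp (- L)"
proof -
  have pk: "norm (peak L (z + of_real t)) \<le> 1" if t: "\<bar>t\<bar> \<le> 1/2" for t :: real
  proof -
    have "cosh (2 * pi * Im z) = cosh (2 * pi * \<bar>Im z\<bar>)"
      using cosh_real_abs[of "2 * pi * Im z"] by (simp add: abs_mult)
    also have "\<dots> \<le> cosh (2 * pi * r)"
      using assms(2) by (subst cosh_real_nonneg_le_iff) auto
    finally have "cos (2 * pi * (Re z + t)) * cosh (2 * pi * Im z) \<le> 1 * cosh (2 * pi * r)"
      by (intro mult_mono) auto
    moreover have "(Im z)\<^sup>2 \<le> r\<^sup>2" using assms(2) by (meson abs_le_square_iff abs_ge_self order_trans)
    moreover have "(\<bar>Re z\<bar> - 1/2)\<^sup>2 \<le> (Re z + t)\<^sup>2"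
      using t assms(3) by (subst abs_le_square_iff[symmetric]) auto
    ultimately show ?thesis
      using assms(1) L by (simp add: norm_peak mult_nonneg_nonpos)
  qed
  show "norm (bump' z) \<le> 8 * exp (- L)"
    using norm_bump'_le[of z 1] pk[of "1/2"] pk[of "-1/2"] by simp
  have "norm (P (z + 1/2) - P (z - 1/2)) \<le> 1 * norm ((z + 1/2) - (z - 1/2))"
  proof (rule field_differentiable_bound[where S="closed_segment (z - 1/2) (z + 1/2)"])
    show "norm (peak L s) \<le> 1" if "s \<in> closed_segment (z - 1/2) (z + 1/2)" for s
    proof -
      from that obtain u where u: "0 \<le> u" "u \<le> 1" "s = (1 - u) *\<^sub>R (z - 1/2) + u *\<^sub>R (z + 1/2)"
        by (auto simp: closed_segment_def)
      then have "s = z + of_real (u - 1/2)"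
        by (simp add: complex_eq_iff algebra_simps)
      moreover have "\<bar>u - 1/2\<bar> \<le> 1/2" using u unfolding abs_le_iff by auto
      ultimately show ?thesis using pk by blast
    qed
  qed (auto intro: has_field_derivative_at_within P)
  then have "norm (P (z + 1/2) - P (z - 1/2)) \<le> 1" by simp
  then have "norm (bump z) \<le> 1 / norm total"
    unfolding bump_def norm_divide by (intro divide_right_mono) auto
  also have "1 / norm total \<le> 1 / (exp L / 4)"
    using norm_total_ge by (intro divide_left_mono) (auto simp: total_nonzero)
  finally show "norm (bump z) \<le> 4 * exp (- L)" by (simp add: exp_minus field_simps)
qed

end


text \<open>Under this condition the exponent of \<^const>\<open>peak\<close> has nonpositive real part at \<open>z - k + t\<close>
  whenever \<open>norm z \<le> r\<close>, \<open>\<bar>k\<bar> > K\<close> and \<open>t \<in> {-1/2..1/2}\<close>.\<close>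

definition strip_distance :: "real \<Rightarrow> nat \<Rightarrow> bool" where
  "strip_distance r K \<longleftrightarrow> 0 \<le> r \<and> r + 1/2 \<le> real K \<and> 4 * cosh (2 * pi * r) + r\<^sup>2 \<le> (real K - r - 1/2)\<^sup>2"

lemma strip_distance_eventually:
  assumes "0 \<le> r"
  obtains K0 where "\<And>K. K0 \<le> K \<Longrightarrow> strip_distance r K"
proof -
  obtain K0 :: nat where K0: "4 * cosh (2 * pi * r) + r\<^sup>2 + r + 2 \<le> real K0"
    using real_arch_simple by blast
  have "strip_distance r K" if "K0 \<le> K" for K
  proof -
    have K: "4 * cosh (2 * pi * r) + r\<^sup>2 + r + 2 \<le> real K"
      using K0 that by linarith
    define A where "A = 4 * cosh (2 * pi * r) + r\<^sup>2"
    have A: "0 \<le> A" by (simp add: A_def)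
    have "A \<le> (A + 1)\<^sup>2" using A by (simp add: power2_sum)
    also have "\<dots> \<le> (real K - r - 1/2)\<^sup>2"
      using K A by (intro power_mono) (auto simp: A_def)
    finally show ?thesis using K A assms unfolding strip_distance_def A_def by linarith
  qed
  then show ?thesis using that by blast
qed

lemma strip_bump:
  fixes k :: int
  assumes "strip_distance r K" "int K < \<bar>k\<bar>" "0 < \<epsilon>"
  obtains f f' :: "complex \<Rightarrow> complex"
  where "\<And>z. (f has_field_derivative f' z) (at z)" "continuous_on UNIV f'"
    and "\<And>z. \<bar>Re z - of_int k\<bar> \<le> 1/8 \<Longrightarrow> norm (f z - 1) \<le> \<epsilon>"
    and "\<And>z j. j \<noteq> k \<Longrightarrow> \<bar>Re z - of_int j\<bar> \<le> 1/8 \<Longrightarrow> norm (f z) \<le> \<epsilon>"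
    and "\<And>z. norm z \<le> r \<Longrightarrow> norm (f z) \<le> \<epsilon>" "\<And>z. norm z \<le> r \<Longrightarrow> norm (f' z) \<le> \<epsilon>"
proof -
  \<comment> \<open>28 = 24 + 4: the oscillation inside a strip from \<open>bump_strip\<close>, plus
    the term \<open>4 * exp (- L)\<close> of \<open>norm_bump_int\<close> at the integer in that
    strip.\<close>
  have "((\<lambda>L. exp (- L / 2) + 28 * exp (- L)) \<longlongrightarrow> 0) (at_top :: real filter)"
    by real_asymp
  then have "eventually (\<lambda>L. exp (- L / 2) + 28 * exp (- L) < \<epsilon>) at_top"
    using assms(3) by (auto simp: order_tendsto_iff)
  then have "eventually (\<lambda>L. exp (- L / 2) + 28 * exp (- L) < \<epsilon> \<and> 1 \<le> L) at_top"
    using eventually_ge_at_top[of 1] by (rule eventually_conj)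
  then obtain L :: real where bound: "exp (- L / 2) + 28 * exp (- L) < \<epsilon>" "1 \<le> L"
    by (auto simp: eventually_at_top_linorder)
  obtain P where P: "\<And>z. (P has_field_derivative peak L z) (at z)"
    using peak_has_primitive by blast
  interpret peak_primitive L P using bound P by unfold_locales auto
  have \<epsilon>: "24 * exp (- L) \<le> \<epsilon>" "4 * exp (- L) \<le> \<epsilon>" "8 * exp (- L) \<le> \<epsilon>"
    using bound(1) exp_gt_zero[of "- L / 2"] exp_gt_zero[of "- L"] by linarith+
  show ?thesis
  proof
    fix z :: complex
    show "((\<lambda>z. bump (z - of_int k)) has_field_derivative bump' (z - of_int k)) (at z)"
    proof -
      have "((\<lambda>z. z - of_int k) has_field_derivative 1) (at z)"
        by (auto intro!: derivative_eq_intros)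
      from DERIV_chain2[OF bump_has_field_derivative this] show ?thesis by simp
    qed
    show "norm (bump (z - of_int k) - 1) \<le> \<epsilon>" if "\<bar>Re z - of_int k\<bar> \<le> 1/8"
      using bump_strip[of "z - of_int k" 0] that \<epsilon> by (simp add: bump_0)
    show "norm (bump (z - of_int k)) \<le> \<epsilon>" if "j \<noteq> k" "\<bar>Re z - of_int j\<bar> \<le> 1/8" for j
      using bump_strip[of "z - of_int k" "j - k"] norm_bump_int[of "j - k"] that bound(1)
        norm_triangle_sub[of "bump (z - of_int k)" "bump (of_int (j - k))"] by simp
    assume z: "norm z \<le> r"
    have "\<bar>Re z\<bar> \<le> r" "\<bar>Im z\<bar> \<le> r"
      using z abs_Re_le_cmod abs_Im_le_cmod order_trans by blast+
    moreover have "real K \<le> \<bar>of_int k\<bar>" using assms(2) by linarith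
    ultimately have *: "real K - r - 1/2 \<le> \<bar>Re (z - of_int k)\<bar> - 1/2" "\<bar>Im (z - of_int k)\<bar> \<le> r"
      by auto
    have K: "0 \<le> real K - r - 1/2" "4 * cosh (2 * pi * r) + r\<^sup>2 \<le> (real K - r - 1/2)\<^sup>2"
      using assms(1) by (auto simp: strip_distance_def)
    have "4 * cosh (2 * pi * r) + r\<^sup>2 \<le> (\<bar>Re (z - of_int k)\<bar> - 1/2)\<^sup>2"
      using power_mono[OF *(1) K(1), of 2] K(2) by linarith
    from bump_far[OF this *(2)] * K(1) \<epsilon>
    show "norm (bump (z - of_int k)) \<le> \<epsilon>" "norm (bump' (z - of_int k)) \<le> \<epsilon>"
      by linarith+
  next
    show "continuous_on UNIV (\<lambda>z. bump' (z - of_int k))"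
      unfolding bump'_def peak_def by (intro continuous_intros) (simp add: total_nonzero)
  qed
qed

section \<open>Clearing squares by sliding rows and columns\<close>

text \<open>A preimage rather than an image: the cells of column k move down by m. This matches the
  way the forbidden set is pulled back when a shear is composed on the inside.\<close>

definition shift_column :: "int \<Rightarrow> int \<Rightarrow> int rel \<Rightarrow> int rel" where
  "shift_column k m S = {(i, j). (i, if i = k then j + m else j) \<in> S}"

text \<open>Only columns with \<open>\<bar>k\<bar> > K\<close> may slide, so that the corresponding
  shears can be close to the identity on a ball. Transposing both ends gives the row slides, as
  conjugates of column slides by the coordinate swap.\<close>

inductive reach :: "nat \<Rightarrow> int rel \<Rightarrow> int rel \<Rightarrow> bool" for K where
  refl: "reach K S S"
| column: "reach K S T \<Longrightarrow> int K < \<bar>k\<bar> \<Longrightarrow> reach K S (shift_column k m T)"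
| transpose: "reach K S T \<Longrightarrow> reach K (S\<inverse>) (T\<inverse>)"

lemma reach_trans: "reach K T U \<Longrightarrow> reach K S T \<Longrightarrow> reach K S U"
proof (induction arbitrary: S rule: reach.induct)
  case (transpose T U)
  from reach.transpose[OF transpose.prems] have "reach K (S\<inverse>) T" by simp
  from reach.transpose[OF transpose.IH[OF this]] show ?case by simp
qed (auto intro: reach.intros)

lemma reach_mono: "reach K S T \<Longrightarrow> L \<le> K \<Longrightarrow> reach L S T"
  by (induction rule: reach.induct) (auto intro: reach.intros)

definition porous :: "int rel \<Rightarrow> bool" where
  "porous S \<longleftrightarrow> (\<forall>i. infinite {j. (i, j) \<notin> S} \<and> infinite {j. (j, i) \<notin> S})"

lemma porous_converse: "porous (S\<inverse>) \<longleftrightarrow> porous S"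
  by (auto simp: porous_def)

text \<open>One column is translated and every row changes in at most one place, so infinitely many
  gaps remain; a requirement of merely one gap per row would not be stable.\<close>

lemma porous_shift_column:
  assumes "porous S"
  shows "porous (shift_column k m S)"
  unfolding porous_def
proof (intro allI conjI)
  fix i
  show "infinite {j. (i, j) \<notin> shift_column k m S}"
  proof (cases "i = k")
    case True
    have "{j. (k, j) \<notin> S} \<subseteq> (\<lambda>j. j + m) ` {j. (k, j) \<notin> shift_column k m S}"
    proof
      fix j assume "j \<in> {j. (k, j) \<notin> S}"
      then have "j - m \<in> {j. (k, j) \<notin> shift_column k m S}" by (simp add: shift_column_def)
      then show "j \<in> (\<lambda>j. j + m) ` {j. (k, j) \<notin> shift_column k m S}"
        by (rule rev_image_eqI) simp
    qed
    then show ?thesis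
      using assms True finite_surj unfolding porous_def by blast
  next
    case False
    then show ?thesis using assms by (simp add: shift_column_def porous_def)
  qed
  have "{j. (j, i) \<notin> S} \<subseteq> insert k {j. (j, i) \<notin> shift_column k m S}"
    by (auto simp: shift_column_def)
  then show "infinite {j. (j, i) \<notin> shift_column k m S}"
    using assms finite_subset unfolding porous_def by blast
qed

lemma porous_reach: "reach K S T \<Longrightarrow> porous S \<Longrightarrow> porous T"
  by (induction rule: reach.induct) (auto simp: porous_converse porous_shift_column)

text \<open>Every row above A has a gap, and sliding that row brings the gap to column k. The rows
  A+1, ..., A+n are treated one at a time and no other row changes. Since only rows slide, k may be
  arbitrary.\<close>

lemma empty_cells_of_column:
  assumes "porous S" "K \<le> A"
  shows "\<exists>T. reach K S T \<and> (\<forall>j. int A < j \<and> j \<le> int A + int n \<longrightarrow> (k, j) \<notin> T) \<and>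
           (\<forall>i j. \<not> (int A < j \<and> j \<le> int A + int n) \<longrightarrow> (i, j) \<in> T \<longleftrightarrow> (i, j) \<in> S)"
proof (induction n)
  case 0
  show ?case by (auto intro: reach.refl)
next
  case (Suc n)
  then obtain T where T: "reach K S T" "\<And>j. int A < j \<Longrightarrow> j \<le> int A + int n \<Longrightarrow> (k, j) \<notin> T"
    "\<And>i j. \<not> (int A < j \<and> j \<le> int A + int n) \<Longrightarrow> (i, j) \<in> T \<longleftrightarrow> (i, j) \<in> S"
    by blast
  define y where "y = int A + int (Suc n)"
  have "infinite {i. (i, y) \<notin> T}"
    using porous_reach[OF T(1) assms(1)] by (simp add: porous_def)
  then obtain x where x: "(x, y) \<notin> T"
    using infinite_imp_nonempty by fastforce
  \<comment> \<open>A row slide, written as a conjugated column slide. It moves the gap at x to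
    position k, and it is allowed because y > A and A is at least K.\<close>
  define U where "U = (shift_column y (x - k) (T\<inverse>))\<inverse>"
  have U: "(i, j) \<in> U \<longleftrightarrow> (if j = y then i + (x - k) else i, j) \<in> T" for i j
    by (simp add: U_def shift_column_def)
  have "reach K (S\<inverse>) (shift_column y (x - k) (T\<inverse>))"
    using assms(2) by (intro reach.column reach.transpose T) (auto simp: y_def)
  from reach.transpose[OF this] have "reach K S U" by (simp add: U_def)
  moreover have "(k, j) \<notin> U" if "int A < j" "j \<le> int A + int (Suc n)" for j
    using x T(2)[of j] that by (cases "j = y") (auto simp: U y_def)
  moreover have "(i, j) \<in> U \<longleftrightarrow> (i, j) \<in> S" if "\<not> (int A < j \<and> j \<le> int A + int (Suc n))" for i j
    using T(3)[of j i] that by (auto simp: U y_def)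
  ultimately show ?case by blast
qed

text \<open>Sliding rows beyond the square opens a gap of 2A+1 cells in column k, just above row A.
  Lowering the column by 2A+1 then fills rows -A, ..., A from the emptied rows A+1, ..., 3A+1, and
  no other column changes in the rows -A, ..., A.\<close>

lemma clear_column:
  assumes "porous S" "K \<le> A" "int K < \<bar>k\<bar>"
  obtains T where "reach K S T" "\<And>j. \<bar>j\<bar> \<le> int A \<Longrightarrow> (k, j) \<notin> T"
    "\<And>i j. i \<noteq> k \<Longrightarrow> \<bar>j\<bar> \<le> int A \<Longrightarrow> (i, j) \<in> T \<longleftrightarrow> (i, j) \<in> S"
proof -
  obtain U where U: "reach K S U" "\<And>j. int A < j \<Longrightarrow> j \<le> int A + int (2 * A + 1) \<Longrightarrow> (k, j) \<notin> U"
    "\<And>i j. \<not> (int A < j \<and> j \<le> int A + int (2 * A + 1)) \<Longrightarrow> (i, j) \<in> U \<longleftrightarrow> (i, j) \<in> S"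
    using empty_cells_of_column[OF assms(1,2), of "2 * A + 1" k] by blast
  define T where "T = shift_column k (2 * int A + 1) U"
  show ?thesis
  proof
    show "reach K S T" unfolding T_def by (intro reach.column U assms)
    show "(k, j) \<notin> T" if "\<bar>j\<bar> \<le> int A" for j
      using U(2)[of "j + (2 * int A + 1)"] that by (auto simp: T_def shift_column_def)
    show "(i, j) \<in> T \<longleftrightarrow> (i, j) \<in> S" if "i \<noteq> k" "\<bar>j\<bar> \<le> int A" for i j
    proof -
      have "\<not> (int A < j \<and> j \<le> int A + int (2 * A + 1))" using that by linarith
      from U(3)[OF this, of i] that show ?thesis by (simp add: T_def shift_column_def)
    qed
  qed
qed

lemma clear_two_columns:
  assumes "porous S"
  obtains T where "reach K S T" "\<And>i j. \<bar>i\<bar> = int K + 1 \<Longrightarrow> \<bar>j\<bar> \<le> int K + 1 \<Longrightarrow> (i, j) \<notin> T"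
    "\<And>i j. \<bar>i\<bar> \<noteq> int K + 1 \<Longrightarrow> \<bar>j\<bar> \<le> int K + 1 \<Longrightarrow> (i, j) \<in> T \<longleftrightarrow> (i, j) \<in> S"
proof -
  obtain U where U: "reach K S U" "\<And>j. \<bar>j\<bar> \<le> int (K + 1) \<Longrightarrow> (int K + 1, j) \<notin> U"
    "\<And>i j. i \<noteq> int K + 1 \<Longrightarrow> \<bar>j\<bar> \<le> int (K + 1) \<Longrightarrow> (i, j) \<in> U \<longleftrightarrow> (i, j) \<in> S"
    using clear_column[OF assms, of K "K + 1" "int K + 1"] by auto
  \<comment> \<open>Clearing the second column leaves the first one untouched in the rows of the
    square.\<close>
  obtain T where T: "reach K U T" "\<And>j. \<bar>j\<bar> \<le> int (K + 1) \<Longrightarrow> (- int K - 1, j) \<notin> T"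
    "\<And>i j. i \<noteq> - int K - 1 \<Longrightarrow> \<bar>j\<bar> \<le> int (K + 1) \<Longrightarrow> (i, j) \<in> T \<longleftrightarrow> (i, j) \<in> U"
    using clear_column[OF porous_reach[OF U(1) assms], of K "K + 1" "- int K - 1"] by auto
  show ?thesis
  proof
    show "reach K S T" by (rule reach_trans[OF T(1) U(1)])
    show "(i, j) \<notin> T" if "\<bar>i\<bar> = int K + 1" "\<bar>j\<bar> \<le> int K + 1" for i j
    proof (cases "i = - int K - 1")
      case True
      then show ?thesis using T(2) that by auto
    next
      case False
      then have "i = int K + 1" using that by linarith
      then show ?thesis using T(3)[of i j] U(2)[of j] that False by auto
    qed
    show "(i, j) \<in> T \<longleftrightarrow> (i, j) \<in> S" if "\<bar>i\<bar> \<noteq> int K + 1" "\<bar>j\<bar> \<le> int K + 1" for i j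
    proof -
      have "i \<noteq> int K + 1" "i \<noteq> - int K - 1" using that(1) by linarith+
      then show ?thesis using T(3)[of i j] U(3)[of i j] that(2) by auto
    qed
  qed
qed

definition avoids_square :: "nat \<Rightarrow> int rel \<Rightarrow> bool" where
  "avoids_square K S \<longleftrightarrow> (\<forall>i j. \<bar>i\<bar> \<le> int K \<longrightarrow> \<bar>j\<bar> \<le> int K \<longrightarrow> (i, j) \<notin> S)"

text \<open>The frame of the larger square consists of two columns and two rows. The columns are
  cleared first, then the rows as columns of the transposed set. Neither pass alters any other cell
  of the larger square, so what was empty stays empty.\<close>

lemma enlarge_square_Suc:
  assumes "porous S" "avoids_square K S"
  obtains T where "reach K S T" "avoids_square (Suc K) T"
proof -
  obtain U where U: "reach K S U"
    "\<And>i j. \<bar>i\<bar> = int K + 1 \<Longrightarrow> \<bar>j\<bar> \<le> int K + 1 \<Longrightarrow> (i, j) \<notin> U"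
    "\<And>i j. \<bar>i\<bar> \<noteq> int K + 1 \<Longrightarrow> \<bar>j\<bar> \<le> int K + 1 \<Longrightarrow> (i, j) \<in> U \<longleftrightarrow> (i, j) \<in> S"
    using clear_two_columns[OF assms(1)] by blast
  have "porous (U\<inverse>)" using porous_reach[OF U(1) assms(1)] by (simp add: porous_converse)
  then obtain T where T: "reach K (U\<inverse>) T"
    "\<And>i j. \<bar>i\<bar> = int K + 1 \<Longrightarrow> \<bar>j\<bar> \<le> int K + 1 \<Longrightarrow> (i, j) \<notin> T"
    "\<And>i j. \<bar>i\<bar> \<noteq> int K + 1 \<Longrightarrow> \<bar>j\<bar> \<le> int K + 1 \<Longrightarrow> (i, j) \<in> T \<longleftrightarrow> (j, i) \<in> U"
    using clear_two_columns by (metis converse_iff)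
  have "reach K U (T\<inverse>)" using reach.transpose[OF T(1)] by simp
  then have "reach K S (T\<inverse>)" using U(1) by (rule reach_trans)
  moreover have "(j, i) \<notin> T" if "\<bar>i\<bar> \<le> int K + 1" "\<bar>j\<bar> \<le> int K + 1" for i j
  proof (cases "\<bar>j\<bar> = int K + 1 \<or> \<bar>i\<bar> = int K + 1")
    case True
    then show ?thesis using T(2)[of j i] T(3)[of j i] U(2)[of i j] that by blast
  next
    case False
    then have "\<bar>i\<bar> \<le> int K" "\<bar>j\<bar> \<le> int K" using that by linarith+
    then show ?thesis
      using T(3)[of j i] U(3)[of i j] assms(2) that False by (auto simp: avoids_square_def)
  qed
  ultimately show ?thesis using that by (simp add: avoids_square_def add.commute)
qed

lemma enlarge_square:
  assumes "porous S" "avoids_square K S"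
  shows "\<exists>T. reach K S T \<and> avoids_square (K + n) T"
proof (induction n)
  case 0
  then show ?case using assms reach.refl by auto
next
  case (Suc n)
  then obtain T where T: "reach K S T" "avoids_square (K + n) T" by blast
  obtain U where "reach (K + n) T U" "avoids_square (Suc (K + n)) U"
    using enlarge_square_Suc[OF porous_reach[OF T(1) assms(1)] T(2)] by blast
  moreover from this(1) have "reach K S U"
    using reach_trans[OF reach_mono T(1)] by simp
  ultimately show ?case by auto
qed

section \<open>Shears that slide columns\<close>

definition cscale :: "complex \<Rightarrow> complex \<times> complex \<Rightarrow> complex \<times> complex" where
  "cscale c v = (c * fst v, c * snd v)"

text \<open>The derivative is a continuous map into the normed space of bounded operators, so that
  C1 closeness can be measured on balls; commuting with \<open>cscale\<close> makes it complex
  linear.\<close>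

definition holo_C1 ::
  "(complex \<times> complex \<Rightarrow> complex \<times> complex) \<Rightarrow>
   (complex \<times> complex \<Rightarrow> (complex \<times> complex) \<Rightarrow>\<^sub>L (complex \<times> complex)) \<Rightarrow> bool" where
  "holo_C1 G D \<longleftrightarrow> (\<forall>p. (G has_derivative blinfun_apply (D p)) (at p)) \<and> continuous_on UNIV D \<and>
     (\<forall>p c v. blinfun_apply (D p) (cscale c v) = cscale c (blinfun_apply (D p) v))"

lemma holo_C1_continuous: "holo_C1 G D \<Longrightarrow> continuous_on A G"
  unfolding holo_C1_def
  by (intro continuous_at_imp_continuous_on ballI) (use has_derivative_continuous in blast)

lemma holo_C1_compose:
  assumes "holo_C1 G D" "holo_C1 H E"
  shows "holo_C1 (G \<circ> H) (\<lambda>p. D (H p) o\<^sub>L E p)"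
  unfolding holo_C1_def
proof (intro conjI allI)
  show "((G \<circ> H) has_derivative blinfun_apply (D (H p) o\<^sub>L E p)) (at p)" for p
    unfolding blinfun_compose.rep_eq
    by (rule diff_chain_at) (use assms in \<open>auto simp: holo_C1_def simp del: split_paired_All\<close>)
  have "continuous_on UNIV (\<lambda>p. D (H p))"
    using assms holo_C1_continuous[OF assms(2)]
    by (intro continuous_on_compose2[of UNIV D UNIV H]) (auto simp: holo_C1_def)
  then show "continuous_on UNIV (\<lambda>p. D (H p) o\<^sub>L E p)"
    using assms(2) by (intro bounded_bilinear.continuous_on[OF bounded_bilinear_blinfun_compose])
      (auto simp: holo_C1_def)
  show "blinfun_apply (D (H p) o\<^sub>L E p) (cscale c v) = cscale c (blinfun_apply (D (H p) o\<^sub>L E p) v)" for p c v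
    using assms by (simp add: holo_C1_def del: split_paired_All)
qed

definition near ::
  "real \<Rightarrow> real \<Rightarrow> ('a \<Rightarrow> 'b) \<Rightarrow> ('a \<Rightarrow> 'c) \<Rightarrow> ('a::real_normed_vector \<Rightarrow> 'b::real_normed_vector) \<Rightarrow>
   ('a \<Rightarrow> 'c::real_normed_vector) \<Rightarrow> bool" where
  "near r \<eta> G D G' D' \<longleftrightarrow>
     (\<forall>p. norm p \<le> r \<longrightarrow> norm (G' p - G p) \<le> \<eta> \<and> norm (D' p - D p) \<le> \<eta>)"

lemma near_trans:
  fixes G G' G'' :: "'a::real_normed_vector \<Rightarrow> 'b::real_normed_vector"
    and D D' D'' :: "'a \<Rightarrow> 'c::real_normed_vector"
  assumes "near r \<eta> G D G' D'" "near r \<theta> G' D' G'' D''"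
  shows "near r (\<eta> + \<theta>) G D G'' D''"
  unfolding near_def
proof (intro allI impI)
  fix p :: 'a assume p: "norm p \<le> r"
  show "norm (G'' p - G p) \<le> \<eta> + \<theta> \<and> norm (D'' p - D p) \<le> \<eta> + \<theta>"
    using assms p norm_triangle_ineq[of "G' p - G p" "G'' p - G' p"]
      norm_triangle_ineq[of "D' p - D p" "D'' p - D' p"]
    unfolding near_def by (force simp: algebra_simps)
qed

text \<open>On the compact ball of radius r + 1 both G and D are uniformly continuous and D is
  bounded by some M. By the chain rule the change of the derivative is
  \<open>(D (H p) - D p) o\<^sub>L E p\<close> plus \<open>D p o\<^sub>L (E p - id_blinfun)\<close>,
  and each summand is made at most \<open>\<eta> / 2\<close>.\<close>

lemma near_compose_near_id:
  assumes G: "holo_C1 G D" and "0 < \<eta>"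
  obtains \<epsilon> where "0 < \<epsilon>"
    "\<And>H E. near r \<epsilon> (\<lambda>p. p) (\<lambda>p. id_blinfun) H E \<Longrightarrow> near r \<eta> G D (G \<circ> H) (\<lambda>p. D (H p) o\<^sub>L E p)"
proof -
  let ?C = "cball (0 :: complex \<times> complex) (r + 1)"
  have D: "continuous_on ?C D" using G continuous_on_subset unfolding holo_C1_def by blast
  have "bounded (D ` ?C)" by (intro compact_imp_bounded compact_continuous_image D compact_cball)
  then obtain M where M: "0 < M" "\<And>p. norm p \<le> r + 1 \<Longrightarrow> norm (D p) \<le> M"
    unfolding bounded_pos by auto
  have "uniformly_continuous_on ?C G" "uniformly_continuous_on ?C D"
    by (auto intro: compact_uniformly_continuous D holo_C1_continuous[OF G])
  then obtain \<delta>1 \<delta>2 where \<delta>: "0 < \<delta>1" "0 < \<delta>2"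
    "\<And>p q. p \<in> ?C \<Longrightarrow> q \<in> ?C \<Longrightarrow> dist q p < \<delta>1 \<Longrightarrow> dist (G q) (G p) < \<eta>"
    "\<And>p q. p \<in> ?C \<Longrightarrow> q \<in> ?C \<Longrightarrow> dist q p < \<delta>2 \<Longrightarrow> dist (D q) (D p) < \<eta> / 4"
    unfolding uniformly_continuous_on_def using \<open>0 < \<eta>\<close>
    by (metis divide_pos_pos zero_less_numeral)
  \<comment> \<open>The bound 1 keeps \<open>H p\<close> in the larger ball and
    \<open>norm (E p)\<close> at most 2, the bound \<open>\<eta> / (2 * M)\<close> serves the second
    summand, and the last two serve uniform continuity.\<close>
  define \<epsilon> where "\<epsilon> = min (min 1 (\<eta> / (2 * M))) (min (\<delta>1 / 2) (\<delta>2 / 2))"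
  have \<epsilon>: "0 < \<epsilon>" "\<epsilon> \<le> 1" "\<epsilon> \<le> \<eta> / (2 * M)" "\<epsilon> < \<delta>1" "\<epsilon> < \<delta>2"
    using \<delta>(1,2) M(1) \<open>0 < \<eta>\<close> unfolding \<epsilon>_def by simp_all
  have "near r \<eta> G D (G \<circ> H) (\<lambda>p. D (H p) o\<^sub>L E p)"
    if "near r \<epsilon> (\<lambda>p. p) (\<lambda>p. id_blinfun) H E" for H E
    unfolding near_def
  proof (intro allI impI)
    fix p :: "complex \<times> complex" assume p: "norm p \<le> r"
    then have H: "norm (H p - p) \<le> \<epsilon>" and E: "norm (E p - id_blinfun) \<le> \<epsilon>"
      using that by (auto simp: near_def simp del: split_paired_All)
    have "norm (H p) \<le> r + 1"
      using H p \<epsilon>(2) norm_triangle_sub[of "H p" p] by linarith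
    then have in_C: "p \<in> ?C" "H p \<in> ?C" using p by auto
    have "dist (G (H p)) (G p) < \<eta>" "dist (D (H p)) (D p) < \<eta> / 4"
      using in_C H \<epsilon> by (intro \<delta>(3,4); simp add: dist_norm)+
    then have GD: "norm (G (H p) - G p) < \<eta>" "norm (D (H p) - D p) < \<eta> / 4"
      by (simp_all add: dist_norm)
    have "norm (E p) \<le> 2"
      using norm_triangle_sub[of "E p" id_blinfun] E \<epsilon>(2) norm_blinfun_id_le[where 'a="complex \<times> complex"]
      by linarith
    have "(D (H p) o\<^sub>L E p) - D p = ((D (H p) - D p) o\<^sub>L E p) + (D p o\<^sub>L (E p - id_blinfun))"
      by (rule blinfun_eqI) (simp add: blinfun.bilinear_simps)
    also have "norm \<dots> \<le> norm (D (H p) - D p) * norm (E p) + norm (D p) * norm (E p - id_blinfun)"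
      by (intro order_trans[OF norm_triangle_ineq] add_mono norm_blinfun_compose)
    also have "\<dots> \<le> \<eta> / 4 * 2 + M * (\<eta> / (2 * M))"
      using GD(2) \<open>norm (E p) \<le> 2\<close> M(1) M(2)[of p] p E \<epsilon>(3) \<open>0 < \<eta>\<close>
      by (intro add_mono mult_mono) auto
    also have "\<dots> = \<eta>" using M(1) by simp
    finally show "norm ((G \<circ> H) p - G p) \<le> \<eta> \<and> norm ((D (H p) o\<^sub>L E p) - D p) \<le> \<eta>"
      using GD(1) by simp
  qed
  with \<epsilon>(1) that show ?thesis by blast
qed

text \<open>The deviation from the identity of the derivative of a shear
  \<open>(z, w) \<mapsto> (z, w + f z)\<close>, with c the value of the derivative of f.\<close>

definition vertical :: "complex \<Rightarrow> (complex \<times> complex) \<Rightarrow>\<^sub>L (complex \<times> complex)" where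
  "vertical c = Blinfun (\<lambda>v. (0, c * fst v))"

lemma blinfun_apply_vertical: "blinfun_apply (vertical c) v = (0, c * fst v)"
  unfolding vertical_def
  by (subst bounded_linear_Blinfun_apply) (auto intro!: bounded_linear_intros)

lemma norm_vertical_le: "norm (vertical c) \<le> norm c"
proof (rule norm_blinfun_bound)
  show "norm (blinfun_apply (vertical c) v) \<le> norm c * norm v" for v
    using norm_fst_le[of "fst v" "snd v"]
    by (simp add: blinfun_apply_vertical norm_Pair norm_mult mult_left_mono)
qed simp

lemma continuous_on_vertical:
  assumes "continuous_on A f"
  shows "continuous_on A (\<lambda>p. vertical (f p))"
proof -
  have "vertical a - vertical b = vertical (a - b)" for a b
    by (rule blinfun_eqI) (simp add: blinfun.bilinear_simps blinfun_apply_vertical left_diff_distrib)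
  then have "dist (vertical a) (vertical b) \<le> dist a b" for a b
    using norm_vertical_le[of "a - b"] by (simp add: dist_norm)
  then have "continuous_on UNIV vertical"
    unfolding continuous_on_iff by (meson le_less_trans)
  then show ?thesis using assms by (rule continuous_on_compose2) auto
qed

lemma holo_C1_shear:
  fixes f f' :: "complex \<Rightarrow> complex"
  assumes "\<And>z. (f has_field_derivative f' z) (at z)" "continuous_on UNIV f'"
  shows "holo_C1 (\<lambda>p. (fst p, snd p + f (fst p))) (\<lambda>p. id_blinfun + vertical (f' (fst p)))"
  unfolding holo_C1_def
proof (intro conjI allI)
  fix p :: "complex \<times> complex"
  have "((\<lambda>p. f (fst p)) has_derivative (\<lambda>h. f' (fst p) * fst h)) (at p)"
    using diff_chain_at[OF has_derivative_fst[OF has_derivative_ident],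
        of f "\<lambda>h. f' (fst p) * h" p] assms(1)[of "fst p"]
    by (simp add: has_field_derivative_def o_def)
  then have "((\<lambda>p. (fst p, snd p + f (fst p))) has_derivative (\<lambda>h. (fst h, snd h + f' (fst p) * fst h))) (at p)"
    by (intro derivative_intros)
  moreover have "blinfun_apply (id_blinfun + vertical (f' (fst p))) = (\<lambda>h. (fst h, snd h + f' (fst p) * fst h))"
    by (auto simp: blinfun.bilinear_simps blinfun_apply_vertical prod_eq_iff)
  ultimately show "((\<lambda>p. (fst p, snd p + f (fst p))) has_derivative
      blinfun_apply (id_blinfun + vertical (f' (fst p)))) (at p)"
    by simp
  show "blinfun_apply (id_blinfun + vertical (f' (fst p))) (cscale c v) =
      cscale c (blinfun_apply (id_blinfun + vertical (f' (fst p))) v)" for c v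
    by (simp add: blinfun.bilinear_simps blinfun_apply_vertical cscale_def algebra_simps)
next
  have "continuous_on UNIV (\<lambda>p :: complex \<times> complex. f' (fst p))"
    by (rule continuous_on_compose2[OF assms(2)]) (auto intro: continuous_intros)
  then show "continuous_on UNIV (\<lambda>p :: complex \<times> complex. id_blinfun + vertical (f' (fst p)))"
    by (intro continuous_intros continuous_on_vertical)
qed

text \<open>Only real parts are constrained, because the functionals used later are integral on the
  lattice only in their real parts.\<close>

definition boxes :: "int rel \<Rightarrow> real \<Rightarrow> (complex \<times> complex) set" where
  "boxes S d = {p. \<exists>i j. (i, j) \<in> S \<and> \<bar>Re (fst p) - of_int i\<bar> < d \<and> \<bar>Re (snd p) - of_int j\<bar> < d}"

lemma open_boxes: "open (boxes S d)"
proof -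
  have "boxes S d = (\<Union>(i, j)\<in>S. {p. \<bar>Re (fst p) - of_int i\<bar> < d} \<inter> {p. \<bar>Re (snd p) - of_int j\<bar> < d})"
    by (auto simp: boxes_def)
  then show ?thesis
    by (auto intro!: open_UN open_Int open_Collect_less continuous_intros)
qed

text \<open>The shear H is composed on the inside, so the preimage of W is pulled back by H. Up to
  an error \<open>\<eta>\<close> in the second real part, H adds m over the strip around k and 0
  over the other integer strips, so the boxes only widen to \<open>d + \<eta>\<close>. The bound 1/8
  keeps every box inside the strips where \<open>strip_bump\<close> applies.\<close>

lemma shift_column_by_shear:
  assumes G: "holo_C1 G D" "G -` W \<subseteq> boxes S d"
    and \<eta>: "0 < \<eta>" "d + \<eta> \<le> 1/8" and K: "strip_distance r K" "int K < \<bar>k\<bar>"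
  obtains G' D' where "holo_C1 G' D'" "G' -` W \<subseteq> boxes (shift_column k m S) (d + \<eta>)" "near r \<eta> G D G' D'"
proof -
  obtain \<epsilon> where \<epsilon>: "0 < \<epsilon>"
    "\<And>H E. near r \<epsilon> (\<lambda>p. p) (\<lambda>p. id_blinfun) H E \<Longrightarrow> near r \<eta> G D (G \<circ> H) (\<lambda>p. D (H p) o\<^sub>L E p)"
    using near_compose_near_id[OF G(1) \<eta>(1)] by blast
  \<comment> \<open>The shear adds m times the bump, so the accuracy is divided by |m|; the summand
    1 covers m = 0.\<close>
  define \<delta> where "\<delta> = min \<epsilon> \<eta> / (\<bar>of_int m\<bar> + 1)"
  have \<delta>: "0 < \<delta>" using \<epsilon>(1) \<eta>(1) by (simp add: \<delta>_def add_nonneg_pos)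
  have "\<bar>of_int m\<bar> * \<delta> \<le> (\<bar>of_int m\<bar> + 1) * \<delta>" using \<delta> by (intro mult_right_mono) auto
  also have "\<dots> = min \<epsilon> \<eta>" by (simp add: \<delta>_def add_nonneg_eq_0_iff)
  finally have m: "\<bar>of_int m\<bar> * \<delta> \<le> \<epsilon>" "\<bar>of_int m\<bar> * \<delta> \<le> \<eta>" by auto
  obtain f f' :: "complex \<Rightarrow> complex" where f: "\<And>z. (f has_field_derivative f' z) (at z)" "continuous_on UNIV f'"
    "\<And>z. \<bar>Re z - of_int k\<bar> \<le> 1/8 \<Longrightarrow> norm (f z - 1) \<le> \<delta>"
    "\<And>z j. j \<noteq> k \<Longrightarrow> \<bar>Re z - of_int j\<bar> \<le> 1/8 \<Longrightarrow> norm (f z) \<le> \<delta>"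
    "\<And>z. norm z \<le> r \<Longrightarrow> norm (f z) \<le> \<delta>" "\<And>z. norm z \<le> r \<Longrightarrow> norm (f' z) \<le> \<delta>"
    using strip_bump[OF K \<delta>] by blast
  define H where "H p = (fst p, snd p + of_int m * f (fst p))" for p :: "complex \<times> complex"
  define E where "E p = id_blinfun + vertical (of_int m * f' (fst p))" for p :: "complex \<times> complex"
  have H: "holo_C1 H E"
    unfolding H_def E_def
    by (rule holo_C1_shear) (auto intro!: derivative_eq_intros f(1) continuous_intros f(2))
  have small: "norm (of_int m * c) \<le> \<bar>of_int m\<bar> * \<delta>" if "norm c \<le> \<delta>" for c :: complex
    using that by (simp add: norm_mult mult_left_mono)
  have "near r \<epsilon> (\<lambda>p. p) (\<lambda>p. id_blinfun) H E"
    unfolding near_def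
  proof (intro allI impI)
    fix p :: "complex \<times> complex" assume "norm p \<le> r"
    then have "norm (fst p) \<le> r" using norm_fst_le[of "fst p" "snd p"] by simp
    then have "norm (of_int m * f (fst p)) \<le> \<epsilon>" "norm (of_int m * f' (fst p)) \<le> \<epsilon>"
      using small f(5,6) m(1) order_trans by blast+
    moreover have "H p - p = (0, of_int m * f (fst p))" by (simp add: H_def prod_eq_iff)
    ultimately show "norm (H p - p) \<le> \<epsilon> \<and> norm (E p - id_blinfun) \<le> \<epsilon>"
      using order_trans[OF norm_vertical_le] by (simp add: E_def norm_Pair)
  qed
  from \<epsilon>(2)[OF this] have *: "near r \<eta> G D (G \<circ> H) (\<lambda>p. D (H p) o\<^sub>L E p)" .
  have "p \<in> boxes (shift_column k m S) (d + \<eta>)" if "G (H p) \<in> W" for p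
  proof -
    from that G(2) have "H p \<in> boxes S d" by auto
    then obtain i j where ij: "(i, j) \<in> S" "\<bar>Re (fst p) - of_int i\<bar> < d"
      "\<bar>Re (snd p) + Re (of_int m * f (fst p)) - of_int j\<bar> < d"
      by (auto simp: boxes_def H_def)
    have i: "\<bar>Re (fst p) - of_int i\<bar> \<le> 1/8" using ij(2) \<eta> by linarith
    show ?thesis
    proof (cases "i = k")
      case True
      have "\<bar>Re (of_int m * (f (fst p) - 1))\<bar> \<le> \<eta>"
        using abs_Re_le_cmod small[OF f(3)] i m(2) True order_trans by meson
      then have "\<bar>Re (of_int m * f (fst p)) - of_int m\<bar> \<le> \<eta>" by (simp add: algebra_simps)
      then have "\<bar>Re (snd p) - of_int (j - m)\<bar> < d + \<eta>"
        using ij(3) unfolding of_int_diff by linarith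
      moreover have "(i, j - m) \<in> shift_column k m S" using ij(1) True by (simp add: shift_column_def)
      ultimately show ?thesis using ij(2) \<eta> unfolding boxes_def by fastforce
    next
      case False
      have "\<bar>Re (of_int m * f (fst p))\<bar> \<le> \<eta>"
        using abs_Re_le_cmod small[OF f(4)] i m(2) False order_trans by meson
      then have "\<bar>Re (snd p) - of_int j\<bar> < d + \<eta>"
        using ij(3) by linarith
      moreover have "(i, j) \<in> shift_column k m S" using ij(1) False by (simp add: shift_column_def)
      ultimately show ?thesis using ij(2) \<eta> unfolding boxes_def by fastforce
    qed
  qed
  then have "(G \<circ> H) -` W \<subseteq> boxes (shift_column k m S) (d + \<eta>)" by auto
  then show ?thesis using that holo_C1_compose[OF G(1) H] * by blast
qed

definition swap_blinfun :: "(complex \<times> complex) \<Rightarrow>\<^sub>L (complex \<times> complex)" where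
  "swap_blinfun = Blinfun prod.swap"

lemma blinfun_apply_swap_blinfun: "blinfun_apply swap_blinfun = prod.swap"
proof -
  have "bounded_linear (\<lambda>p :: complex \<times> complex. (snd p, fst p))"
    by (intro bounded_linear_Pair bounded_linear_fst bounded_linear_snd)
  moreover have "(\<lambda>p :: complex \<times> complex. (snd p, fst p)) = prod.swap" by auto
  ultimately show ?thesis
    unfolding swap_blinfun_def by (simp add: bounded_linear_Blinfun_apply)
qed

lemma norm_swap: "norm (prod.swap p) = norm (p :: complex \<times> complex)"
  by (cases p) (simp add: norm_Pair add.commute)

lemma norm_swap_blinfun_le: "norm swap_blinfun \<le> 1"
  by (rule norm_blinfun_bound) (simp_all add: blinfun_apply_swap_blinfun norm_swap)

lemma holo_C1_swap: "holo_C1 G D \<Longrightarrow> holo_C1 (G \<circ> prod.swap) (\<lambda>p. D (prod.swap p) o\<^sub>L swap_blinfun)"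
proof (rule holo_C1_compose)
  have "(prod.swap has_derivative blinfun_apply swap_blinfun) (at p)" for p
    using bounded_linear_imp_has_derivative[OF blinfun.bounded_linear_right[of swap_blinfun]]
    by (simp add: blinfun_apply_swap_blinfun)
  then show "holo_C1 prod.swap (\<lambda>p. swap_blinfun)"
    by (auto simp: holo_C1_def blinfun_apply_swap_blinfun cscale_def)
qed

lemma boxes_converse: "prod.swap -` boxes S d = boxes (S\<inverse>) d"
  by (auto simp: boxes_def)

lemma near_swap:
  fixes G G' :: "complex \<times> complex \<Rightarrow> complex \<times> complex"
    and D D' :: "complex \<times> complex \<Rightarrow> (complex \<times> complex) \<Rightarrow>\<^sub>L (complex \<times> complex)"
  assumes "near r \<eta> G D G' D'"
  shows "near r \<eta> (G \<circ> prod.swap) (\<lambda>p. D (prod.swap p) o\<^sub>L swap_blinfun)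
           (G' \<circ> prod.swap) (\<lambda>p. D' (prod.swap p) o\<^sub>L swap_blinfun)"
  unfolding near_def
proof (intro allI impI)
  fix p :: "complex \<times> complex" assume "norm p \<le> r"
  then have p: "norm (G' (prod.swap p) - G (prod.swap p)) \<le> \<eta>" "norm (D' (prod.swap p) - D (prod.swap p)) \<le> \<eta>"
    using assms norm_swap[of p] by (auto simp: near_def simp del: split_paired_All)
  have "(D' (prod.swap p) o\<^sub>L swap_blinfun) - (D (prod.swap p) o\<^sub>L swap_blinfun) =
      (D' (prod.swap p) - D (prod.swap p)) o\<^sub>L swap_blinfun"
    by (rule blinfun_eqI) (simp add: blinfun.bilinear_simps)
  also have "norm \<dots> \<le> norm (D' (prod.swap p) - D (prod.swap p)) * 1"
    by (intro order_trans[OF norm_blinfun_compose] mult_left_mono norm_swap_blinfun_le) auto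
  finally show "norm ((G' \<circ> prod.swap) p - (G \<circ> prod.swap) p) \<le> \<eta> \<and>
      norm ((D' (prod.swap p) o\<^sub>L swap_blinfun) - (D (prod.swap p) o\<^sub>L swap_blinfun)) \<le> \<eta>"
    using p by simp
qed

text \<open>A column move gives half of the allowance \<open>\<eta>\<close> to the earlier moves and
  half to its own shear. A transposition is realised by composing with the coordinate swap before
  and after; being an isometry, the swap preserves closeness on balls.\<close>

lemma reach_by_automorphism:
  assumes "reach K S T" "strip_distance r K" "holo_C1 G D" "G -` W \<subseteq> boxes S d" "0 < \<eta>" "d + \<eta> \<le> 1/8"
  shows "\<exists>G' D'. holo_C1 G' D' \<and> G' -` W \<subseteq> boxes T (d + \<eta>) \<and> near r \<eta> G D G' D'"
  using assms
proof (induction arbitrary: G D d \<eta> rule: reach.induct)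
  case (refl S)
  have "boxes S d \<subseteq> boxes S (d + \<eta>)"
    using refl unfolding boxes_def by fastforce
  moreover have "near r \<eta> G D G D" using refl by (simp add: near_def)
  ultimately show ?case using refl by blast
next
  case (column S T k m)
  have \<eta>: "0 < \<eta> / 2" "d + \<eta> / 2 \<le> 1/8" "d + \<eta> / 2 + \<eta> / 2 \<le> 1/8" using column.prems by auto
  obtain G1 D1 where 1: "holo_C1 G1 D1" "G1 -` W \<subseteq> boxes T (d + \<eta> / 2)" "near r (\<eta> / 2) G D G1 D1"
    using column.IH[OF column.prems(1,2,3) \<eta>(1,2)] by blast
  obtain G2 D2 where 2: "holo_C1 G2 D2" "G2 -` W \<subseteq> boxes (shift_column k m T) (d + \<eta> / 2 + \<eta> / 2)"
    "near r (\<eta> / 2) G1 D1 G2 D2"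
    using shift_column_by_shear[OF 1(1,2) \<eta>(1,3) column.prems(1) column.hyps(2)] by blast
  have "near r \<eta> G D G2 D2" using near_trans[OF 1(3) 2(3)] by simp
  moreover have "d + \<eta> / 2 + \<eta> / 2 = d + \<eta>" by simp
  ultimately show ?case using 2(1,2) by metis
next
  case (transpose S T)
  have "(G \<circ> prod.swap) -` W \<subseteq> boxes S d"
    using transpose.prems(3) boxes_converse[of "S\<inverse>" d] by (auto simp: vimage_comp[symmetric])
  then obtain G' D' where G': "holo_C1 G' D'" "G' -` W \<subseteq> boxes T (d + \<eta>)"
    "near r \<eta> (G \<circ> prod.swap) (\<lambda>p. D (prod.swap p) o\<^sub>L swap_blinfun) G' D'"
    using transpose.IH[OF transpose.prems(1) holo_C1_swap[OF transpose.prems(2)] _ transpose.prems(4,5)] by blast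
  have "(G' \<circ> prod.swap) -` W \<subseteq> boxes (T\<inverse>) (d + \<eta>)"
    using G'(2) boxes_converse[of T "d + \<eta>"] by (auto simp: vimage_comp[symmetric])
  moreover have "swap_blinfun o\<^sub>L swap_blinfun = id_blinfun"
    by (rule blinfun_eqI) (simp add: blinfun_apply_swap_blinfun)
  then have "D p o\<^sub>L swap_blinfun o\<^sub>L swap_blinfun = D p" for p
    by (intro blinfun_eqI) (simp add: blinfun_apply_swap_blinfun)
  with near_swap[OF G'(3)]
  have "near r \<eta> G D (G' \<circ> prod.swap) (\<lambda>p. D' (prod.swap p) o\<^sub>L swap_blinfun)"
    by (simp add: o_def)
  ultimately show ?case using holo_C1_swap[OF G'(1)] by blast
qed

section \<open>The limit map\<close>

lemma geometric_increments_limit: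
  fixes x :: "nat \<Rightarrow> 'a::banach"
  assumes "\<And>n. N \<le> n \<Longrightarrow> norm (x (Suc n) - x n) \<le> c / 2 ^ n" "0 \<le> c"
  obtains l where "x \<longlonglongrightarrow> l" "\<And>n. N \<le> n \<Longrightarrow> norm (x n - l) \<le> 2 * c / 2 ^ n"
proof -
  \<comment> \<open>The factor \<open>1 - 1 / 2 ^ m\<close> is the partial geometric sum; with the
    final bound alone the induction would not close.\<close>
  have inc: "norm (x (n + m) - x n) \<le> 2 * c / 2 ^ n * (1 - 1 / 2 ^ m)" if "N \<le> n" for n m
  proof (induction m)
    case (Suc m)
    have "norm (x (n + Suc m) - x n) \<le> norm (x (Suc (n + m)) - x (n + m)) + norm (x (n + m) - x n)"
      using norm_triangle_ineq[of "x (Suc (n + m)) - x (n + m)" "x (n + m) - x n"] by simp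
    also have "\<dots> \<le> c / 2 ^ (n + m) + 2 * c / 2 ^ n * (1 - 1 / 2 ^ m)"
      using assms(1)[of "n + m"] Suc that by simp
    also have "\<dots> = 2 * c / 2 ^ n * (1 - 1 / 2 ^ Suc m)"
      by (simp add: power_add field_simps)
    finally show ?case .
  qed simp
  have tail: "norm (x (n + m) - x n) \<le> 2 * c / 2 ^ n" if "N \<le> n" for n m
  proof -
    have "2 * c / 2 ^ n * (1 - 1 / 2 ^ m) \<le> 2 * c / 2 ^ n * 1"
      using assms(2) by (intro mult_left_mono) auto
    then show ?thesis using inc[OF that, of m] by simp
  qed
  have "Cauchy x"
  proof (rule CauchyI)
    fix e :: real assume "0 < e"
    have "(\<lambda>n. 2 * c / 2 ^ n) \<longlonglongrightarrow> 0" by real_asymp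
    then have "eventually (\<lambda>n. 2 * c / 2 ^ n < e / 2) sequentially"
      using \<open>0 < e\<close> order_tendstoD(2) half_gt_zero by blast
    then obtain M where M: "N \<le> M" "2 * c / 2 ^ M < e / 2"
      unfolding eventually_sequentially by (metis max.cobounded1 max.cobounded2)
    show "\<exists>M. \<forall>m\<ge>M. \<forall>n\<ge>M. norm (x m - x n) < e"
    proof (intro exI[of _ M] allI impI)
      fix m n assume "M \<le> m" "M \<le> n"
      then have "norm (x m - x M) \<le> 2 * c / 2 ^ M" "norm (x n - x M) \<le> 2 * c / 2 ^ M"
        using tail[OF M(1), of "m - M"] tail[OF M(1), of "n - M"] by simp_all
      then show "norm (x m - x n) < e"
        using norm_triangle_ineq4[of "x m - x M" "x n - x M"] M(2) by simp
    qed
  qed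
  then obtain l where l: "x \<longlonglongrightarrow> l" using convergent_eq_Cauchy by (auto simp: convergent_def)
  have "norm (x n - l) \<le> 2 * c / 2 ^ n" if "N \<le> n" for n
  proof -
    have "(\<lambda>m. norm (x (m + n) - x n)) \<longlonglongrightarrow> norm (l - x n)"
      by (intro tendsto_intros LIMSEQ_ignore_initial_segment l)
    then have "norm (l - x n) \<le> 2 * c / 2 ^ n"
      by (rule LIMSEQ_le_const2) (use tail[OF that] in \<open>auto simp: add.commute\<close>)
    then show ?thesis by (simp add: norm_minus_commute)
  qed
  then show ?thesis using l that by blast
qed

text \<open>On a fixed ball the increments are geometric as soon as n exceeds its radius. The
  derivatives therefore converge uniformly on balls, which makes their limit the derivative of F,
  and complex linearity passes to pointwise limits.\<close>

lemma holomorphic_limit: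
  fixes G :: "nat \<Rightarrow> complex \<times> complex \<Rightarrow> complex \<times> complex"
    and D :: "nat \<Rightarrow> complex \<times> complex \<Rightarrow> (complex \<times> complex) \<Rightarrow>\<^sub>L (complex \<times> complex)"
  assumes G: "\<And>n. holo_C1 (G n) (D n)"
    and near: "\<And>n. near n (c / 2 ^ n) (G n) (D n) (G (Suc n)) (D (Suc n))" and "0 \<le> c"
  obtains F F' where "\<And>p. (\<lambda>n. G n p) \<longlonglongrightarrow> F p" "\<And>p. (F has_derivative blinfun_apply (F' p)) (at p)"
    "\<And>p a v. blinfun_apply (F' p) (cscale a v) = cscale a (blinfun_apply (F' p) v)"
    "norm (D 0 0 - F' 0) \<le> 2 * c"
proof -
  have GD: "norm (G (Suc n) p - G n p) \<le> c / 2 ^ n" "norm (D (Suc n) p - D n p) \<le> c / 2 ^ n"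
    if "norm p \<le> real n" for p n
    using near[of n] that by (auto simp: near_def simp del: split_paired_All)
  have "\<exists>l. (\<lambda>n. G n p) \<longlonglongrightarrow> l" for p
  proof -
    obtain N where N: "norm p \<le> real N" using real_arch_simple by blast
    show ?thesis
      by (rule geometric_increments_limit[of N "\<lambda>n. G n p" c]) (use GD(1) N \<open>0 \<le> c\<close> in \<open>auto simp del: split_paired_Ex\<close>)
  qed
  then obtain F where F: "\<And>p. (\<lambda>n. G n p) \<longlonglongrightarrow> F p" by metis
  have "\<exists>l. (\<lambda>n. D n p) \<longlonglongrightarrow> l \<and> (\<forall>n. norm p \<le> real n \<longrightarrow> norm (D n p - l) \<le> 2 * c / 2 ^ n)" for p
  proof -
    \<comment> \<open>The exact threshold, so that the error bound holds for every n with
      \<open>norm p \<le> n\<close>. It thereby becomes uniform on balls, and at p = 0 it holds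
      already for n = 0.\<close>
    define N where "N = nat \<lceil>norm p\<rceil>"
    have N: "N \<le> n \<longleftrightarrow> norm p \<le> real n" for n by (auto simp: N_def nat_ceiling_le_eq)
    obtain l where "(\<lambda>n. D n p) \<longlonglongrightarrow> l" "\<And>n. N \<le> n \<Longrightarrow> norm (D n p - l) \<le> 2 * c / 2 ^ n"
      using geometric_increments_limit[of N "\<lambda>n. D n p" c] GD(2) N \<open>0 \<le> c\<close> by blast
    then show ?thesis using N by blast
  qed
  then obtain F' where F': "\<And>p. (\<lambda>n. D n p) \<longlonglongrightarrow> F' p"
    "\<And>p n. norm p \<le> real n \<Longrightarrow> norm (D n p - F' p) \<le> 2 * c / 2 ^ n"
    by metis
  show ?thesis
  proof
    show "(\<lambda>n. G n p) \<longlonglongrightarrow> F p" for p by (rule F)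
    show "norm (D 0 0 - F' 0) \<le> 2 * c" using F'(2)[of 0 0] by simp
    have ap: "(\<lambda>n. blinfun_apply (D n p) v) \<longlonglongrightarrow> blinfun_apply (F' p) v" for p v
      by (intro tendsto_intros F')
    show "blinfun_apply (F' p) (cscale a v) = cscale a (blinfun_apply (F' p) v)" for p a v
    proof (rule LIMSEQ_unique[OF ap])
      have "(\<lambda>n. cscale a (blinfun_apply (D n p) v)) \<longlonglongrightarrow> cscale a (blinfun_apply (F' p) v)"
        unfolding cscale_def by (intro tendsto_intros ap)
      then show "(\<lambda>n. blinfun_apply (D n p) (cscale a v)) \<longlonglongrightarrow> cscale a (blinfun_apply (F' p) v)"
        using G by (simp add: holo_C1_def del: split_paired_All)
    qed
    show "(F has_derivative blinfun_apply (F' p)) (at p)" for p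
    proof -
      define R where "R = norm p + 1"
      let ?B = "ball (0 :: complex \<times> complex) R"
      have "\<exists>g. \<forall>x\<in>?B. (\<lambda>n. G n x) \<longlonglongrightarrow> g x \<and> (g has_derivative blinfun_apply (F' x)) (at x within ?B)"
      proof (rule has_derivative_sequence[where f'="\<lambda>n x. blinfun_apply (D n x)"])
        show "(G n has_derivative blinfun_apply (D n x)) (at x within ?B)" for n x
          using G by (auto simp: holo_C1_def intro: has_derivative_at_withinI simp del: split_paired_All)
        show "\<forall>\<^sub>F n in sequentially. \<forall>x\<in>?B. \<forall>h. norm (blinfun_apply (D n x) h - blinfun_apply (F' x) h) \<le> e * norm h"
          if "0 < e" for e
        proof -
          have "(\<lambda>n. 2 * c / 2 ^ n) \<longlonglongrightarrow> 0" by real_asymp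
          then have "eventually (\<lambda>n. 2 * c / 2 ^ n < e) sequentially"
            using \<open>0 < e\<close> order_tendstoD(2) by blast
          moreover obtain N where "R \<le> real N" using real_arch_simple by blast
          then have "eventually (\<lambda>n. R \<le> real n) sequentially"
            by (intro eventually_sequentiallyI[of N]) auto
          ultimately show ?thesis
          proof eventually_elim
            case (elim n)
            show ?case
            proof (intro ballI allI)
              fix x h :: "complex \<times> complex" assume "x \<in> ?B"
              then have "norm x \<le> real n" using elim by simp
              then have "norm (D n x - F' x) \<le> e" using F'(2) elim by fastforce
              then have "norm (blinfun_apply (D n x - F' x) h) \<le> e * norm h"
                by (meson mult_right_mono norm_blinfun norm_ge_zero order_trans)
              then show "norm (blinfun_apply (D n x) h - blinfun_apply (F' x) h) \<le> e * norm h"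
                by (simp add: blinfun.bilinear_simps)
            qed
          qed
        qed
        show "(0 :: complex \<times> complex) \<in> ?B" by (auto simp: R_def add_nonneg_pos)
        show "(\<lambda>n. G n 0) \<longlonglongrightarrow> F 0" by (rule F)
      qed auto
      then obtain g where g: "\<And>x. x \<in> ?B \<Longrightarrow> (\<lambda>n. G n x) \<longlonglongrightarrow> g x"
        "\<And>x. x \<in> ?B \<Longrightarrow> (g has_derivative blinfun_apply (F' x)) (at x within ?B)"
        by blast
      have p: "p \<in> ?B" by (simp add: R_def)
      have "g x = F x" if "x \<in> ?B" for x using LIMSEQ_unique[OF g(1)[OF that] F] .
      then have "(F has_derivative blinfun_apply (F' p)) (at p within ?B)"
        using has_derivative_transform[OF p _ g(2)[OF p]] by metis
      then show ?thesis using at_within_open[OF p open_ball] by simp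
    qed
  qed
qed

text \<open>K is fixed before S, so that the scale of the lattice S can be chosen afterwards. At
  stage n the forbidden set, pulled back by \<open>G n\<close>, lies in boxes around a set missing
  the square of size \<open>K n\<close>, and the next map differs little from \<open>G n\<close> on
  the ball of radius n.\<close>

lemma holomorphic_map_avoiding_boxes:
  obtains K where "\<And>S. porous S \<Longrightarrow> avoids_square K S \<Longrightarrow>
    \<exists>F F'. (\<forall>p. (F has_derivative blinfun_apply (F' p)) (at p)) \<and>
      (\<forall>p a v. blinfun_apply (F' p) (cscale a v) = cscale a (blinfun_apply (F' p) v)) \<and>
      inj (blinfun_apply (F' 0)) \<and> range F \<inter> boxes S (1/16) = {}"
proof -
  have "\<forall>n. \<exists>K0. \<forall>K\<ge>K0. strip_distance (real n) K"
    using strip_distance_eventually by (metis of_nat_0_le_iff)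
  then obtain \<kappa> where \<kappa>: "\<And>n K. \<kappa> n \<le> K \<Longrightarrow> strip_distance (real n) K" by metis
  \<comment> \<open>Summing makes the sequence monotone and at least \<open>\<kappa> n\<close>; the
    summand n forces the squares to exhaust the plane.\<close>
  define K where "K n = n + (\<Sum>i\<le>n. \<kappa> i)" for n
  have K: "strip_distance (real n) (K n)" for n
    using \<kappa> sum_nonneg_leq_bound[of "{..n}" \<kappa>] member_le_sum[of n "{..n}" \<kappa>] by (simp add: K_def trans_le_add2)
  have K_mono: "K n \<le> K (Suc n)" and K_ge: "n \<le> K n" for n by (auto simp: K_def)
  \<comment> \<open>The box widths grow from 1/16 and never pass 1/8; the increments
    \<open>(1/32) / 2 ^ n\<close> serve also as the closeness bounds.\<close>
  define d :: "nat \<Rightarrow> real" where "d n = 1/8 - (1/16) / 2 ^ n" for n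
  have d: "d 0 = 1/16" "d n + (1/32) / 2 ^ n = d (Suc n)" "d n \<le> 1/8" for n
    by (simp_all add: d_def field_simps)
  have "\<exists>F F'. (\<forall>p. (F has_derivative blinfun_apply (F' p)) (at p)) \<and>
      (\<forall>p a v. blinfun_apply (F' p) (cscale a v) = cscale a (blinfun_apply (F' p) v)) \<and>
      inj (blinfun_apply (F' 0)) \<and> range F \<inter> boxes S (1/16) = {}"
    if S: "porous S" "avoids_square (K 0) S" for S
  proof -
    define Inv where "Inv n = (\<lambda>(G, D, T). holo_C1 G D \<and> porous T \<and> avoids_square (K n) T \<and>
      G -` boxes S (1/16) \<subseteq> boxes T (d n) \<and> (n = 0 \<longrightarrow> D = (\<lambda>p. id_blinfun)))" for n
    define Step where "Step n = (\<lambda>(G :: complex \<times> complex \<Rightarrow> complex \<times> complex,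
        D :: complex \<times> complex \<Rightarrow> (complex \<times> complex) \<Rightarrow>\<^sub>L (complex \<times> complex), T :: int rel)
        (G', D', T' :: int rel). near (real n) ((1/32) / 2 ^ n) G D G' D')" for n
    have "\<exists>f. \<forall>n. Inv n (f n) \<and> Step n (f n) (f (Suc n))"
    proof (rule dependent_nat_choice)
      have "holo_C1 (\<lambda>p. p) (\<lambda>p. id_blinfun)"
        by (auto simp: holo_C1_def)
      then show "\<exists>x. Inv 0 x"
        using S by (intro exI[of _ "((\<lambda>p. p), (\<lambda>p. id_blinfun), S)"]) (simp add: Inv_def d vimage_def)
    next
      fix x n assume "Inv n x"
      then obtain G D T where x: "x = (G, D, T)" "holo_C1 G D" "porous T" "avoids_square (K n) T"
        "G -` boxes S (1/16) \<subseteq> boxes T (d n)"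
        by (auto simp: Inv_def split: prod.splits)
      obtain T' where T': "reach (K n) T T'" "avoids_square (K (Suc n)) T'"
        using enlarge_square[OF x(3,4), of "K (Suc n) - K n"] K_mono[of n] by auto
      obtain G' D' where "holo_C1 G' D'" "G' -` boxes S (1/16) \<subseteq> boxes T' (d (Suc n))"
        "near (real n) ((1/32) / 2 ^ n) G D G' D'"
        using reach_by_automorphism[OF T'(1) K x(2,5), of "(1/32) / 2 ^ n", unfolded d(2)] d(3)[of "Suc n"]
        by auto
      then show "\<exists>y. Inv (Suc n) y \<and> Step n x y"
        using T' porous_reach[OF T'(1) x(3)]
        by (intro exI[of _ "(G', D', T')"]) (simp add: Inv_def Step_def x(1) d)
    qed
    then obtain f where f: "\<And>n. Inv n (f n)" "\<And>n. Step n (f n) (f (Suc n))" by blast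
    define G where "G n = fst (f n)" for n
    define D where "D n = fst (snd (f n))" for n
    define T where "T n = snd (snd (f n))" for n
    have f_eq: "f n = (G n, D n, T n)" for n by (simp add: G_def D_def T_def)
    have inv: "holo_C1 (G n) (D n)" "avoids_square (K n) (T n)" "G n -` boxes S (1/16) \<subseteq> boxes (T n) (d n)" for n
      using f(1)[of n] by (auto simp: Inv_def f_eq)
    have D0: "D 0 = (\<lambda>p. id_blinfun)" using f(1)[of 0] by (simp add: Inv_def f_eq)
    have near: "near (real n) ((1/32) / 2 ^ n) (G n) (D n) (G (Suc n)) (D (Suc n))" for n
      using f(2)[of n] by (simp add: Step_def f_eq)
    obtain F F' where F: "\<And>p. (\<lambda>n. G n p) \<longlonglongrightarrow> F p" "\<And>p. (F has_derivative blinfun_apply (F' p)) (at p)"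
      "\<And>p a v. blinfun_apply (F' p) (cscale a v) = cscale a (blinfun_apply (F' p) v)"
      "norm (D 0 0 - F' 0) \<le> 2 * (1/32)"
      using holomorphic_limit[OF inv(1) near] by auto
    \<comment> \<open>The starting map is the identity, and the derivative at the origin has moved
      by at most 1/16 in operator norm, so it remains injective.\<close>
    have "v = 0" if "blinfun_apply (F' 0) v = 0" for v
    proof -
      have "norm v = norm (blinfun_apply (D 0 0 - F' 0) v)"
        using that by (simp add: D0 blinfun.bilinear_simps)
      also have "\<dots> \<le> 2 * (1/32) * norm v"
        using F(4) by (meson mult_right_mono norm_blinfun norm_ge_zero order_trans)
      finally show ?thesis by simp
    qed
    then have "inj (blinfun_apply (F' 0))"
      using linear_injective_0[OF bounded_linear.linear[OF blinfun.bounded_linear_right]] by blast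
    moreover have "F p \<notin> boxes S (1/16)" for p
    proof
      assume "F p \<in> boxes S (1/16)"
      \<comment> \<open>The boxes are open, so \<open>G n p\<close> lies in them for all large n.
        Then p itself lies in boxes around \<open>T n\<close>, although for n beyond
        \<open>norm p\<close> the square missed by \<open>T n\<close> is too large for that.\<close>
      then have "eventually (\<lambda>n. G n p \<in> boxes S (1/16)) sequentially"
        using F(1) open_boxes topological_tendstoD by blast
      then obtain N where N: "\<And>n. N \<le> n \<Longrightarrow> G n p \<in> boxes S (1/16)"
        by (auto simp: eventually_sequentially)
      obtain M where M: "norm p < real M" using reals_Archimedean2 by blast
      let ?n = "max N M"
      have "p \<in> boxes (T ?n) (d ?n)" using N[of ?n] inv(3)[of ?n] by auto
      then obtain i j where ij: "(i, j) \<in> T ?n" "\<bar>Re (fst p) - of_int i\<bar> < 1/8" "\<bar>Re (snd p) - of_int j\<bar> < 1/8"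
        using d(3)[of ?n] by (fastforce simp: boxes_def)
      have "norm (fst p) \<le> norm p" "norm (snd p) \<le> norm p"
        using norm_fst_le[of "fst p" "snd p"] norm_snd_le[of "snd p" "fst p"] by simp_all
      then have "\<bar>Re (fst p)\<bar> \<le> norm p" "\<bar>Re (snd p)\<bar> \<le> norm p"
        using abs_Re_le_cmod order_trans by blast+
      moreover have "real M \<le> real (K ?n)" using K_ge[of ?n] by linarith
      ultimately have "\<bar>real_of_int i\<bar> < real (K ?n) + 1" "\<bar>real_of_int j\<bar> < real (K ?n) + 1"
        using ij(2,3) M by linarith+
      then have "\<bar>i\<bar> \<le> int (K ?n)" "\<bar>j\<bar> \<le> int (K ?n)" by linarith+
      then show False using ij(1) inv(2)[of ?n] by (auto simp: avoids_square_def)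
    qed
    ultimately show ?thesis using F(2,3) by (intro exI[of _ F] exI[of _ F']) auto
  qed
  then show ?thesis using that by blast
qed

section \<open>Lattices and tori\<close>

text \<open>The functional \<open>\<phi> v - \<i> * \<phi> (\<i> * v)\<close> is complex linear and
  has real part \<open>\<phi> v\<close>; a and b are its values on the two standard basis
  vectors.\<close>

lemma real_linear_functional_complex2:
  fixes \<phi> :: "complex^2 \<Rightarrow> real"
  assumes "linear \<phi>"
  shows "\<exists>a b. \<forall>v. \<phi> v = Re (a * v $ 1 + b * v $ 2)"
proof -
  define a where "a = Complex (\<phi> (vector [1, 0])) (- \<phi> (vector [\<i>, 0]))"
  define b where "b = Complex (\<phi> (vector [0, 1])) (- \<phi> (vector [0, \<i>]))"
  have "\<phi> v = Re (a * v $ 1 + b * v $ 2)" for v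
  proof -
    have "v = Re (v $ 1) *\<^sub>R vector [1, 0] + Im (v $ 1) *\<^sub>R vector [\<i>, 0] +
        (Re (v $ 2) *\<^sub>R vector [0, 1] + Im (v $ 2) *\<^sub>R vector [0, \<i>])"
      by (simp add: vec_eq_iff forall_2 complex_eq_iff)
    from arg_cong[OF this, of \<phi>]
    have "\<phi> v = Re (v $ 1) * \<phi> (vector [1, 0]) + Im (v $ 1) * \<phi> (vector [\<i>, 0]) +
        (Re (v $ 2) * \<phi> (vector [0, 1]) + Im (v $ 2) * \<phi> (vector [0, \<i>]))"
      by (simp only: linear_add[OF assms] linear_scale[OF assms] real_scaleR_def)
    then show ?thesis by (simp add: a_def b_def)
  qed
  then show ?thesis by blast
qed

text \<open>Four independent vectors form a real basis of the space. The functionals are the dual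
  basis, written as real parts of complex functionals.\<close>

lemma lattice_coordinates:
  assumes "lattice_rank4 \<Lambda>"
  obtains B :: "(complex^2) set" and \<alpha> \<beta> where "finite B" "B \<noteq> {}"
    "\<And>b v. b \<in> B \<Longrightarrow> v \<in> \<Lambda> \<Longrightarrow> Re (\<alpha> b * v $ 1 + \<beta> b * v $ 2) \<in> \<int>"
    "\<And>b. b \<in> B \<Longrightarrow> Re (\<alpha> b * b $ 1 + \<beta> b * b $ 2) = 1"
    "\<And>v :: complex^2. (\<And>b. b \<in> B \<Longrightarrow> Re (\<alpha> b * v $ 1 + \<beta> b * v $ 2) = 0) \<Longrightarrow> v = 0"
proof -
  obtain B where B: "independent B" "card B = 4"
    "\<Lambda> = range (\<lambda>k :: complex^2 \<Rightarrow> int. \<Sum>b\<in>B. of_int (k b) *\<^sub>R b)"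
    using assms unfolding lattice_rank4_def by blast
  have fin: "finite B" "B \<noteq> {}" using B(2) by (auto intro: card_ge_0_finite)
  have "dim (UNIV :: (complex^2) set) \<le> card B" by (simp add: B(2))
  then have span: "span B = UNIV"
    using card_ge_dim_independent[of B UNIV] B(1) by auto
  have "\<exists>g :: complex^2 \<Rightarrow> real. linear g \<and> (\<forall>x\<in>B. g x = (if x = b then 1 else 0))" for b
    by (rule linear_independent_extend[OF B(1)])
  then obtain \<phi> :: "complex^2 \<Rightarrow> complex^2 \<Rightarrow> real" where
    \<phi>: "\<And>b. linear (\<phi> b)" "\<And>b x. x \<in> B \<Longrightarrow> \<phi> b x = (if x = b then 1 else 0)"
    by metis
  have coord: "\<phi> b (\<Sum>x\<in>B. u x *\<^sub>R x) = u b" if "b \<in> B" for u b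
  proof -
    have "\<phi> b (\<Sum>x\<in>B. u x *\<^sub>R x) = (\<Sum>x\<in>B. u x * \<phi> b x)"
      by (simp add: linear_sum[OF \<phi>(1)] linear_scale[OF \<phi>(1)])
    also have "\<dots> = (\<Sum>x\<in>B. if x = b then u x else 0)" by (rule sum.cong) (auto simp: \<phi>(2))
    finally show ?thesis using that fin by simp
  qed
  obtain \<alpha> \<beta> where \<alpha>\<beta>: "\<And>b v. \<phi> b v = Re (\<alpha> b * v $ 1 + \<beta> b * v $ 2)"
    using real_linear_functional_complex2[OF \<phi>(1)] by metis
  show ?thesis
  proof
    show "Re (\<alpha> b * v $ 1 + \<beta> b * v $ 2) \<in> \<int>" if "b \<in> B" "v \<in> \<Lambda>" for b v
      using that coord B(3) unfolding \<alpha>\<beta>[symmetric] by auto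
    show "Re (\<alpha> b * b $ 1 + \<beta> b * b $ 2) = 1" if "b \<in> B" for b
      using \<phi>(2)[OF that] unfolding \<alpha>\<beta>[symmetric] by simp
    show "v = 0" if "\<And>b. b \<in> B \<Longrightarrow> Re (\<alpha> b * v $ 1 + \<beta> b * v $ 2) = 0" for v :: "complex^2"
    proof -
      have "v \<in> range (\<lambda>u. \<Sum>x\<in>B. u x *\<^sub>R x)" using span span_finite[OF fin(1)] by auto
      then obtain u where v: "v = (\<Sum>x\<in>B. u x *\<^sub>R x)" by auto
      have "u b = 0" if "b \<in> B" for b
        using coord[OF that, of u] \<open>\<And>b. b \<in> B \<Longrightarrow> Re (\<alpha> b * v $ 1 + \<beta> b * v $ 2) = 0\<close>[OF that]
        unfolding \<alpha>\<beta>[symmetric] v by simp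
      then show ?thesis by (simp add: v)
    qed
  qed (use fin in auto)
qed

lemma lattice_integral_functionals:
  assumes "lattice_rank4 \<Lambda>"
  obtains a b c d :: complex where "a * d - b * c \<noteq> 0"
    "\<And>v. v \<in> \<Lambda> \<Longrightarrow> Re (a * v $ 1 + b * v $ 2) \<in> \<int>"
    "\<And>v. v \<in> \<Lambda> \<Longrightarrow> Re (c * v $ 1 + d * v $ 2) \<in> \<int>"
proof -
  obtain B :: "(complex^2) set" and \<alpha> \<beta> where B: "finite B" "B \<noteq> {}"
    "\<And>b v. b \<in> B \<Longrightarrow> v \<in> \<Lambda> \<Longrightarrow> Re (\<alpha> b * v $ 1 + \<beta> b * v $ 2) \<in> \<int>"
    "\<And>b. b \<in> B \<Longrightarrow> Re (\<alpha> b * b $ 1 + \<beta> b * b $ 2) = 1"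
    "\<And>v :: complex^2. (\<And>b. b \<in> B \<Longrightarrow> Re (\<alpha> b * v $ 1 + \<beta> b * v $ 2) = 0) \<Longrightarrow> v = 0"
    using lattice_coordinates[OF assms] by blast
  obtain e where e: "e \<in> B" using B(2) by blast
  \<comment> \<open>\<open>v\<close> spans the kernel of the functional of \<open>e\<close>; not all functionals vanish on it.\<close>
  define v :: "complex^2" where "v = vector [- \<beta> e, \<alpha> e]"
  have "\<exists>e'\<in>B. \<alpha> e * \<beta> e' - \<beta> e * \<alpha> e' \<noteq> 0"
  proof (rule ccontr)
    assume "\<not> ?thesis"
    then have "\<alpha> b * v $ 1 + \<beta> b * v $ 2 = 0" if "b \<in> B" for b
      using that by (auto simp: v_def algebra_simps)
    then have "v = 0" using B(5)[of v] by simp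
    then have "\<alpha> e = 0" "\<beta> e = 0" by (simp_all add: v_def vec_eq_iff forall_2)
    then show False using B(4)[OF e] by simp
  qed
  then show ?thesis using that B(3) e by blast
qed

lemma lattice_diff_zero:
  assumes "lattice_rank4 \<Lambda>"
  shows "0 \<in> \<Lambda>" "v \<in> \<Lambda> \<Longrightarrow> w \<in> \<Lambda> \<Longrightarrow> v - w \<in> \<Lambda>"
proof -
  obtain B :: "(complex^2) set" where B: "\<Lambda> = range (\<lambda>k :: complex^2 \<Rightarrow> int. \<Sum>b\<in>B. of_int (k b) *\<^sub>R b)"
    using assms unfolding lattice_rank4_def by blast
  show "0 \<in> \<Lambda>" unfolding B by (rule range_eqI[of _ _ "\<lambda>_. 0"]) simp
  assume "v \<in> \<Lambda>" "w \<in> \<Lambda>"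
  then obtain k l :: "complex^2 \<Rightarrow> int" where
    "v = (\<Sum>b\<in>B. of_int (k b) *\<^sub>R b)" "w = (\<Sum>b\<in>B. of_int (l b) *\<^sub>R b)"
    unfolding B by blast
  then have "v - w = (\<Sum>b\<in>B. of_int (k b - l b) *\<^sub>R b)"
    by (simp add: scaleR_left_diff_distrib sum_subtractf)
  then show "v - w \<in> \<Lambda>" unfolding B by (rule range_eqI[of _ _ "\<lambda>b. k b - l b"])
qed

text \<open>On a small ball all coordinates have absolute value below 1; those of a lattice vector
  are integers and hence vanish.\<close>

lemma lattice_discrete:
  assumes "lattice_rank4 \<Lambda>"
  obtains r where "0 < r" "\<And>v. v \<in> \<Lambda> \<Longrightarrow> norm v < r \<Longrightarrow> v = 0"
proof -
  obtain B :: "(complex^2) set" and \<alpha> \<beta> where B: "finite B" "B \<noteq> {}"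
    "\<And>b v. b \<in> B \<Longrightarrow> v \<in> \<Lambda> \<Longrightarrow> Re (\<alpha> b * v $ 1 + \<beta> b * v $ 2) \<in> \<int>"
    "\<And>b. b \<in> B \<Longrightarrow> Re (\<alpha> b * b $ 1 + \<beta> b * b $ 2) = 1"
    "\<And>v :: complex^2. (\<And>b. b \<in> B \<Longrightarrow> Re (\<alpha> b * v $ 1 + \<beta> b * v $ 2) = 0) \<Longrightarrow> v = 0"
    using lattice_coordinates[OF assms] by blast
  have "eventually (\<lambda>v :: complex^2. \<bar>Re (\<alpha> b * v $ 1 + \<beta> b * v $ 2)\<bar> < 1) (nhds 0)" for b
  proof -
    have "open {v :: complex^2. \<bar>Re (\<alpha> b * v $ 1 + \<beta> b * v $ 2)\<bar> < 1}"
      by (intro open_Collect_less continuous_intros)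
    from eventually_nhds_in_open[OF this, of 0] show ?thesis by simp
  qed
  then have "eventually (\<lambda>v :: complex^2. \<forall>b\<in>B. \<bar>Re (\<alpha> b * v $ 1 + \<beta> b * v $ 2)\<bar> < 1) (nhds 0)"
    using B(1) by (intro eventually_ball_finite) auto
  then obtain r where r: "0 < r" "\<And>v :: complex^2. norm v < r \<Longrightarrow> \<forall>b\<in>B. \<bar>Re (\<alpha> b * v $ 1 + \<beta> b * v $ 2)\<bar> < 1"
    unfolding eventually_nhds_metric dist_norm diff_zero by blast
  have "v = 0" if "v \<in> \<Lambda>" "norm v < r" for v
  proof (rule B(5))
    show "Re (\<alpha> b * v $ 1 + \<beta> b * v $ 2) = 0" if "b \<in> B" for b
      using Ints_nonzero_abs_less1[OF B(3)[OF that \<open>v \<in> \<Lambda>\<close>]] r(2)[OF \<open>norm v < r\<close>] that by simp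
  qed
  then show ?thesis using r(1) that by blast
qed

section \<open>The projection and the charts of the torus\<close>

context
  fixes \<Lambda> :: "(complex^2) set"
  assumes \<Lambda>: "lattice_rank4 \<Lambda>"
begin

lemma lattice_add: "v \<in> \<Lambda> \<Longrightarrow> w \<in> \<Lambda> \<Longrightarrow> v + w \<in> \<Lambda>"
  using lattice_diff_zero(2)[OF \<Lambda>, of v "0 - w"]
    lattice_diff_zero(2)[OF \<Lambda> lattice_diff_zero(1)[OF \<Lambda>], of w] by simp

lemma torus_proj_eq_iff: "torus_proj \<Lambda> z = torus_proj \<Lambda> w \<longleftrightarrow> z - w \<in> \<Lambda>"
proof
  assume "torus_proj \<Lambda> z = torus_proj \<Lambda> w"
  moreover have "w \<in> torus_proj \<Lambda> w"
    using lattice_diff_zero(1)[OF \<Lambda>] by (simp add: torus_proj_def lattice_rel_def)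
  ultimately show "z - w \<in> \<Lambda>" by (auto simp: torus_proj_def lattice_rel_def)
next
  assume *: "z - w \<in> \<Lambda>"
  have "z - x \<in> \<Lambda> \<longleftrightarrow> w - x \<in> \<Lambda>" for x
    using lattice_add[OF *, of "w - x"] lattice_diff_zero(2)[OF \<Lambda> _ *, of "z - x"] by auto
  then show "torus_proj \<Lambda> z = torus_proj \<Lambda> w" by (auto simp: torus_proj_def lattice_rel_def)
qed

text \<open>The preimage of the image of V is the union of the lattice translates of V.\<close>

lemma openin_torus_proj_image:
  assumes "open V"
  shows "openin (torus \<Lambda>) (torus_proj \<Lambda> ` V)"
proof -
  have "torus_proj \<Lambda> -` (torus_proj \<Lambda> ` V) = (\<Union>l\<in>\<Lambda>. (+) l ` V)"
  proof (intro equalityI subsetI)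
    fix z assume "z \<in> torus_proj \<Lambda> -` (torus_proj \<Lambda> ` V)"
    then obtain v where "v \<in> V" "z - v \<in> \<Lambda>" by (auto simp: torus_proj_eq_iff)
    then show "z \<in> (\<Union>l\<in>\<Lambda>. (+) l ` V)"
      by (intro UN_I[of "z - v"] rev_image_eqI[of v]) auto
  next
    fix z assume "z \<in> (\<Union>l\<in>\<Lambda>. (+) l ` V)"
    then obtain l v where z: "l \<in> \<Lambda>" "v \<in> V" "z = l + v" by auto
    then have "torus_proj \<Lambda> z = torus_proj \<Lambda> v" by (simp add: torus_proj_eq_iff)
    then show "z \<in> torus_proj \<Lambda> -` (torus_proj \<Lambda> ` V)" using z(2) by auto
  qed
  then have "open (torus_proj \<Lambda> -` (torus_proj \<Lambda> ` V))"
    using assms by (auto intro!: open_UN open_translation)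
  moreover have "torus_proj \<Lambda> ` V \<subseteq> UNIV // lattice_rel \<Lambda>"
    by (auto simp: torus_proj_def quotient_def)
  ultimately show ?thesis by (simp add: openin_torus)
qed

text \<open>Near z the chart expression is G minus the constant lattice vector that carries
  \<open>G z\<close> into V, so it has the same derivative as G.\<close>

lemma chart_of_projection_has_derivative:
  assumes V: "chart_domain \<Lambda> V" "torus_proj \<Lambda> (G z) \<in> torus_proj \<Lambda> ` V"
    and G: "(G has_derivative L) (at z)"
  shows "((torus_chart \<Lambda> V \<circ> (torus_proj \<Lambda> \<circ> G)) has_derivative L) (at z)"
proof -
  obtain v where v: "v \<in> V" "G z - v \<in> \<Lambda>" using V(2) by (auto simp: torus_proj_eq_iff)
  define H where "H p = G p - (G z - v)" for p
  have H: "(H has_derivative L) (at z)"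
    unfolding H_def by (auto intro!: derivative_eq_intros G)
  have "H z \<in> V" using v by (simp add: H_def)
  have "open V" using V(1) by (simp add: chart_domain_def)
  have chart: "H p = (torus_chart \<Lambda> V \<circ> (torus_proj \<Lambda> \<circ> G)) p" if "H p \<in> V" for p
  proof -
    have "torus_proj \<Lambda> (G p) = torus_proj \<Lambda> (H p)" using v(2) by (simp add: torus_proj_eq_iff H_def)
    then show ?thesis
      using that V(1) by (simp add: torus_chart_def chart_domain_def inv_into_f_f)
  qed
  have "eventually (\<lambda>p. H p \<in> V) (at z)"
    using topological_tendstoD \<open>H z \<in> V\<close> \<open>open V\<close> has_derivative_continuous[OF H] unfolding continuous_at by blast
  then have "eventually (\<lambda>p. H p = (torus_chart \<Lambda> V \<circ> (torus_proj \<Lambda> \<circ> G)) p) (at z)"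
  proof eventually_elim
    case (elim p)
    then show ?case by (rule chart)
  qed
  from has_derivative_transform_eventually[OF H this] show ?thesis
    using chart[OF \<open>H z \<in> V\<close>] by (simp add: o_def)
qed

lemma torus_dominating_projection:
  fixes G :: "complex^2 \<Rightarrow> complex^2"
  assumes G: "\<And>z. (G has_derivative L z) (at z)" "\<And>z. Vector_Spaces.linear (*s) (*s) (L z)"
    and "inj (L z0)"
  shows "torus_dominating \<Lambda> (torus_proj \<Lambda> \<circ> G)"
  unfolding torus_dominating_def
proof
  have "continuous_on UNIV G"
    by (intro continuous_at_imp_continuous_on ballI) (use G(1) has_derivative_continuous in blast)
  then have "continuous_map euclidean euclidean G" by simp
  then have cont: "continuous_map euclidean (torus \<Lambda>) (torus_proj \<Lambda> \<circ> G)"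
    using quotient_imp_continuous_map[OF quotient_map_torus_proj] continuous_map_compose by blast
  show "torus_holomorphic \<Lambda> (torus_proj \<Lambda> \<circ> G)"
    unfolding torus_holomorphic_def holomorphic_map_on_def
  proof (intro conjI cont allI impI ballI)
    fix V assume V: "chart_domain \<Lambda> V"
    then have "openin (torus \<Lambda>) (torus_proj \<Lambda> ` V)"
      by (intro openin_torus_proj_image) (simp add: chart_domain_def)
    from openin_continuous_map_preimage[OF cont this]
    show "open ((torus_proj \<Lambda> \<circ> G) -` torus_proj \<Lambda> ` V)" by (simp add: vimage_def)
    fix z assume "z \<in> (torus_proj \<Lambda> \<circ> G) -` torus_proj \<Lambda> ` V"
    then have "((torus_chart \<Lambda> V \<circ> (torus_proj \<Lambda> \<circ> G)) has_derivative L z) (at z)"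
      by (intro chart_of_projection_has_derivative V G) simp
    then show "\<exists>L. Vector_Spaces.linear (*s) (*s) L \<and>
        ((torus_chart \<Lambda> V \<circ> (torus_proj \<Lambda> \<circ> G)) has_derivative L) (at z)"
      using G(2) by blast
  qed
  obtain r where r: "0 < r" "\<And>v. v \<in> \<Lambda> \<Longrightarrow> norm v < r \<Longrightarrow> v = 0"
    using lattice_discrete[OF \<Lambda>] by blast
  \<comment> \<open>Two points of a ball of radius r/2 differ by less than r, so they are equal if
    they differ by a lattice vector.\<close>
  define V where "V = ball (G z0) (r / 2)"
  have "inj_on (torus_proj \<Lambda>) V"
  proof (rule inj_onI)
    fix v w assume "v \<in> V" "w \<in> V" "torus_proj \<Lambda> v = torus_proj \<Lambda> w"
    then have "v - w \<in> \<Lambda>" "dist v w < r / 2 + r / 2"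
      using dist_triangle_less_add[of v "G z0" "r / 2" w "r / 2"]
      by (auto simp: torus_proj_eq_iff V_def dist_commute)
    then show "v = w" using r(2)[of "v - w"] by (simp add: dist_norm)
  qed
  then have V: "chart_domain \<Lambda> V" by (simp add: chart_domain_def V_def)
  have z0: "(torus_proj \<Lambda> \<circ> G) z0 \<in> torus_proj \<Lambda> ` V" using r(1) by (simp add: V_def)
  then have "((torus_chart \<Lambda> V \<circ> (torus_proj \<Lambda> \<circ> G)) has_derivative L z0) (at z0)"
    by (intro chart_of_projection_has_derivative V G) simp
  then have "complex_jacobian_det (torus_chart \<Lambda> V \<circ> (torus_proj \<Lambda> \<circ> G)) z0 = det (matrix (L z0))"
    unfolding complex_jacobian_det_def by (simp add: frechet_derivative_at[symmetric])
  moreover have "(*v) (matrix (L z0)) = L z0"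
    using matrix_works[OF G(2)] by blast
  then have "invertible (matrix (L z0))"
    using assms(3) by (simp add: invertible_left_inverse matrix_left_invertible_injective)
  then have "det (matrix (L z0)) \<noteq> 0" by (simp add: invertible_det_nz)
  ultimately show "\<exists>z V. chart_domain \<Lambda> V \<and> (torus_proj \<Lambda> \<circ> G) z \<in> torus_proj \<Lambda> ` V \<and>
      complex_jacobian_det (torus_chart \<Lambda> V \<circ> (torus_proj \<Lambda> \<circ> G)) z \<noteq> 0"
    by (intro exI[of _ z0] exI[of _ V] conjI V z0) simp
qed

end

lemma simultaneous_approximation:
  fixes T :: "real set"
  assumes "finite T" "0 < N"
  obtains q :: int where "0 < q" "\<And>t. t \<in> T \<Longrightarrow> \<exists>m. \<bar>of_int q * t - of_int m\<bar> < 1 / real N"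
proof -
  obtain h where h: "bij_betw h {0..<card T} T"
    using ex_bij_betw_nat_finite[OF assms(1)] by blast
  obtain q p where q: "0 < q" "\<And>i. i < card T \<Longrightarrow> \<bar>of_int q * h i - of_int (p i)\<bar> < 1 / real N"
    using Dirichlet_approx_simult[OF assms(2), of "card T" h] by metis
  have "\<exists>m. \<bar>of_int q * t - of_int m\<bar> < 1 / real N" if "t \<in> T" for t
  proof -
    have "t \<in> h ` {0..<card T}" using h that by (simp add: bij_betw_def)
    then obtain i where "i < card T" "t = h i" by auto
    then show ?thesis using q(2) by blast
  qed
  then show ?thesis using q(1) that by blast
qed

section \<open>The dominating map\<close>

text \<open>The translate of the lattice of multiples of 2M by (M, M). The offset keeps it away from
  the origin, and the even multiples of M provide gaps in every row and column.\<close>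

definition odd_multiples :: "int \<Rightarrow> int rel" where
  "odd_multiples M = {(i, j). (\<exists>x. i = M * (2 * x + 1)) \<and> (\<exists>y. j = M * (2 * y + 1))}"

lemma even_multiple_neq_odd_multiple: "M \<noteq> 0 \<Longrightarrow> M * (2 * x) \<noteq> M * (2 * y + 1)" for M :: int
proof
  assume "M \<noteq> 0" "M * (2 * x) = M * (2 * y + 1)"
  then have "2 * x = 2 * y + 1" by simp
  then show False by presburger
qed

lemma porous_odd_multiples:
  assumes "M \<noteq> 0"
  shows "porous (odd_multiples M)"
proof -
  have "inj (\<lambda>x :: int. M * (2 * x))" using assms by (auto simp: inj_def)
  then have inf: "infinite (range (\<lambda>x :: int. M * (2 * x)))"
    using range_inj_infinite[of "\<lambda>x :: int. M * (2 * x)"] infinite_UNIV_int finite_imageD by blast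
  have sub: "range (\<lambda>x. M * (2 * x)) \<subseteq> {j. (i, j) \<notin> odd_multiples M}"
    "range (\<lambda>x. M * (2 * x)) \<subseteq> {j. (j, i) \<notin> odd_multiples M}" for i
    using even_multiple_neq_odd_multiple[OF assms] by (auto simp: odd_multiples_def)
  show ?thesis
    using infinite_super[OF sub(1) inf] infinite_super[OF sub(2) inf] by (simp add: porous_def)
qed

lemma avoids_square_odd_multiples: "avoids_square K (odd_multiples (int K + 1))"
proof -
  have "int K + 1 \<le> \<bar>(int K + 1) * (2 * x + 1)\<bar>" for x :: int
  proof -
    have "1 \<le> \<bar>2 * x + 1\<bar>" by presburger
    then have "(int K + 1) * 1 \<le> (int K + 1) * \<bar>2 * x + 1\<bar>" by (intro mult_left_mono) auto
    then show ?thesis by (simp add: abs_mult)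
  qed
  then have "\<not> \<bar>(int K + 1) * (2 * x + 1)\<bar> \<le> int K" for x
    by (meson less_le_not_le order_trans zless_add1_eq)
  then show ?thesis unfolding avoids_square_def odd_multiples_def by blast
qed

theorem corollary6p2:
  fixes \<Lambda> :: "(complex^2) set" and E :: "(complex^2) set set"
  assumes "lattice_rank4 \<Lambda>"
    and "E \<subseteq> topspace (torus \<Lambda>)" and "finite E"
  shows "\<exists>U F. openin (torus \<Lambda>) U \<and> E \<subseteq> U \<and>
           torus_dominating \<Lambda> F \<and> range F \<subseteq> topspace (torus \<Lambda>) - U"
proof -
  obtain a b c d :: complex where det: "a * d - b * c \<noteq> 0"
    and int1: "\<And>v. v \<in> \<Lambda> \<Longrightarrow> Re (a * v $ 1 + b * v $ 2) \<in> \<int>"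
    and int2: "\<And>v. v \<in> \<Lambda> \<Longrightarrow> Re (c * v $ 1 + d * v $ 2) \<in> \<int>"
    by (rule lattice_integral_functionals[OF assms(1)]) blast
  define l1 where "l1 v = a * v $ 1 + b * v $ 2" for v :: "complex^2"
  define l2 where "l2 v = c * v $ 1 + d * v $ 2" for v :: "complex^2"
  obtain K where K: "\<And>S. porous S \<Longrightarrow> avoids_square K S \<Longrightarrow>
    \<exists>F F'. (\<forall>p. (F has_derivative blinfun_apply (F' p)) (at p)) \<and>
      (\<forall>p a v. blinfun_apply (F' p) (cscale a v) = cscale a (blinfun_apply (F' p) v)) \<and>
      inj (blinfun_apply (F' 0)) \<and> range F \<inter> boxes S (1/16) = {}"
    by (rule holomorphic_map_avoiding_boxes) blast
  define M where "M = int K + 1"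
  have M: "0 < M" by (simp add: M_def)
  obtain F F' where F: "\<And>p. (F has_derivative blinfun_apply (F' p)) (at p)"
    "\<And>p a v. blinfun_apply (F' p) (cscale a v) = cscale a (blinfun_apply (F' p) v)"
    "inj (blinfun_apply (F' 0))" "range F \<inter> boxes (odd_multiples M) (1/16) = {}"
    using K[OF porous_odd_multiples avoids_square_odd_multiples] M unfolding M_def by auto
  have "topspace (torus \<Lambda>) = range (torus_proj \<Lambda>)"
    by (auto simp: topspace_torus torus_proj_def quotient_def)
  then obtain Z where Z: "finite Z" "E = torus_proj \<Lambda> ` Z"
    using assms(2,3) finite_subset_image by metis
  \<comment> \<open>Chosen so that an error below 1/N, scaled by 2M, stays below the box width
    1/16.\<close>
  define N where "N = 32 * nat M"
  have N: "0 < N" "2 * of_int M * (1 / real N) = 1/16" using M by (simp_all add: N_def)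
  have "finite ((\<lambda>v. Re (l1 v)) ` Z \<union> (\<lambda>v. Re (l2 v)) ` Z)" using Z(1) by simp
  then obtain q :: int where q: "0 < q"
    "\<And>t. t \<in> (\<lambda>v. Re (l1 v)) ` Z \<union> (\<lambda>v. Re (l2 v)) ` Z \<Longrightarrow> \<exists>m. \<bar>of_int q * t - of_int m\<bar> < 1 / real N"
    by (rule simultaneous_approximation[OF _ N(1)]) blast
  \<comment> \<open>The full preimage in the plane of the open set U: the points whose q-fold has
    both functionals with real part close to an integer.\<close>
  define V where "V = {v. \<exists>x y :: int. \<bar>of_int q * Re (l1 v) - of_int x\<bar> < 1 / real N \<and>
    \<bar>of_int q * Re (l2 v) - of_int y\<bar> < 1 / real N}"
  have "V = (\<Union>x y :: int. {v. \<bar>of_int q * Re (l1 v) - of_int x\<bar> < 1 / real N} \<inter>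
      {v. \<bar>of_int q * Re (l2 v) - of_int y\<bar> < 1 / real N})"
    by (auto simp: V_def)
  then have "open V"
    unfolding l1_def l2_def by (auto intro!: open_UN open_Int open_Collect_less continuous_intros)
  have V_invariant: "v \<in> V" if u: "u \<in> V" and vu: "v - u \<in> \<Lambda>" for u v
  proof -
    obtain x y :: int where xy: "\<bar>of_int q * Re (l1 u) - of_int x\<bar> < 1 / real N"
      "\<bar>of_int q * Re (l2 u) - of_int y\<bar> < 1 / real N"
      using u by (auto simp: V_def)
    obtain m1 m2 where m: "Re (l1 (v - u)) = of_int m1" "Re (l2 (v - u)) = of_int m2"
      using int1[OF vu] int2[OF vu] by (auto simp: l1_def l2_def elim!: Ints_cases)
    have l: "l1 (v - u) = l1 v - l1 u" "l2 (v - u) = l2 v - l2 u"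
      by (simp_all add: l1_def l2_def algebra_simps)
    \<comment> \<open>The functionals have integral real part on the lattice, so a lattice
      translation only changes the approximating integers.\<close>
    have "of_int q * Re (l1 v) - of_int (x + q * m1) = of_int q * Re (l1 u) - of_int x"
      "of_int q * Re (l2 v) - of_int (y + q * m2) = of_int q * Re (l2 u) - of_int y"
      using m unfolding l by (simp_all add: algebra_simps)
    with xy show ?thesis unfolding V_def by (metis (mono_tags, lifting) mem_Collect_eq)
  qed
  \<comment> \<open>Multiplying by s takes the values of \<open>l1\<close> and \<open>l2\<close> on
    V to points with real parts near multiples of 2M; adding M makes these odd multiples of
    M.\<close>
  define s :: complex where "s = of_int (2 * M * q)"
  have s: "s \<noteq> 0" using M q(1) by (simp add: s_def)
  \<comment> \<open>Cramer's rule for the inverse of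
    \<open>v \<mapsto> (s * l1 v, s * l2 v)\<close>.\<close>
  define A :: "complex \<times> complex \<Rightarrow> complex^2" where
    "A P = vector [(d * fst P - b * snd P) / ((a * d - b * c) * s), (a * snd P - c * fst P) / ((a * d - b * c) * s)]" for P
  have A: "s * l1 (A P) = fst P" "s * l2 (A P) = snd P" for P
  proof -
    have "l1 (A P) = (a * (d * fst P - b * snd P) + b * (a * snd P - c * fst P)) / ((a * d - b * c) * s)"
      by (simp add: l1_def A_def add_divide_distrib)
    also have "\<dots> = ((a * d - b * c) * fst P) / ((a * d - b * c) * s)" by (simp add: algebra_simps)
    finally show "s * l1 (A P) = fst P" using det s by simp
    have "l2 (A P) = (c * (d * fst P - b * snd P) + d * (a * snd P - c * fst P)) / ((a * d - b * c) * s)"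
      by (simp add: l2_def A_def add_divide_distrib)
    also have "\<dots> = ((a * d - b * c) * snd P) / ((a * d - b * c) * s)" by (simp add: algebra_simps)
    finally show "s * l2 (A P) = snd P" using det s by simp
  qed
  have A_cscale: "A (cscale r P) = r *s A P" for r P
    by (simp add: A_def cscale_def vec_eq_iff forall_2 right_diff_distrib algebra_simps)
  have A_linear: "linear A"
  proof (rule linearI)
    show "A (P + Q) = A P + A Q" for P Q
      by (simp add: A_def vec_eq_iff forall_2 add_divide_distrib diff_divide_distrib algebra_simps)
    have "r *\<^sub>R P = cscale (of_real r) P" for r P
      by (simp add: cscale_def prod_eq_iff scaleR_conv_of_real)
    moreover have "of_real r *s v = r *\<^sub>R v" for r and v :: "complex^2"
      by (simp only: vec_eq_iff vector_smult_component vector_scaleR_component scaleR_conv_of_real[where 'a=complex] simp_thms)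
    ultimately show "A (r *\<^sub>R P) = r *\<^sub>R A P" for r P
      by (simp add: A_cscale)
  qed
  define B :: "complex^2 \<Rightarrow> complex \<times> complex" where "B v = (v $ 1, v $ 2)" for v
  have B: "(B has_derivative B) (at v)" for v
    unfolding B_def
    by (intro bounded_linear_imp_has_derivative bounded_linear_Pair bounded_linear_vec_nth)
  \<comment> \<open>F avoids boxes around odd multiples of M; subtracting (M, M) turns these into
    multiples of 2M, and A carries the result to the lattice coordinates.\<close>
  define G where "G v = A (F (B v) - (of_int M, of_int M))" for v
  define L where "L v h = A (blinfun_apply (F' (B v)) (B h))" for v h
  have G: "(G has_derivative L v) (at v)" for v
  proof -
    have "((\<lambda>v. F (B v)) has_derivative (\<lambda>h. blinfun_apply (F' (B v)) (B h))) (at v)"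
      using diff_chain_at[OF B F(1)] by (simp add: o_def)
    then have "((\<lambda>v. F (B v) - (of_int M, of_int M)) has_derivative (\<lambda>h. blinfun_apply (F' (B v)) (B h))) (at v)"
      by (auto intro!: derivative_eq_intros)
    from bounded_linear.has_derivative[OF linear_conv_bounded_linear[THEN iffD1, OF A_linear] this]
    show ?thesis by (simp add: G_def[abs_def] L_def[abs_def])
  qed
  have "Vector_Spaces.linear (*s) (*s) (L v)" for v
  proof unfold_locales
    show "L v (h + k) = L v h + L v k" for h k
    proof -
      have "B (h + k) = B h + B k" by (simp add: B_def)
      then show ?thesis by (simp add: L_def blinfun.bilinear_simps linear_add[OF A_linear])
    qed
    show "L v (r *s h) = r *s L v h" for r h
    proof -
      have "B (r *s h) = cscale r (B h)" by (simp add: B_def cscale_def)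
      then show ?thesis by (simp add: L_def F(2) A_cscale)
    qed
  qed
  moreover have "inj (L 0)"
  proof -
    have "inj A" by (rule injI) (metis A prod_eqI)
    moreover have "inj B" by (rule injI) (simp add: B_def vec_eq_iff forall_2)
    moreover have "B 0 = 0" by (simp add: B_def zero_prod_def)
    ultimately show ?thesis
      using F(3) unfolding L_def inj_def by metis
  qed
  ultimately have dom: "torus_dominating \<Lambda> (torus_proj \<Lambda> \<circ> G)"
    using torus_dominating_projection[OF assms(1) G] by blast
  have "G p \<notin> V" for p
  proof
    assume "G p \<in> V"
    then obtain x y :: int where xy: "\<bar>of_int q * Re (l1 (G p)) - of_int x\<bar> < 1 / real N"
      "\<bar>of_int q * Re (l2 (G p)) - of_int y\<bar> < 1 / real N"
      by (auto simp: V_def)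
    have "s * l1 (G p) = fst (F (B p)) - of_int M" "s * l2 (G p) = snd (F (B p)) - of_int M"
      unfolding G_def A by simp_all
    then have "Re (fst (F (B p))) = of_int M + Re (s * l1 (G p))" "Re (snd (F (B p))) = of_int M + Re (s * l2 (G p))"
      by simp_all
    \<comment> \<open>As s is real, \<open>Re (s * l1 v)\<close> equals 2M times
      \<open>q * Re (l1 v)\<close>, so closeness to x becomes closeness to M(2x+1) after adding
      M.\<close>
    then have Re: "Re (fst (F (B p))) - of_int (M * (2 * x + 1)) = 2 * of_int M * (of_int q * Re (l1 (G p)) - of_int x)"
      "Re (snd (F (B p))) - of_int (M * (2 * y + 1)) = 2 * of_int M * (of_int q * Re (l2 (G p)) - of_int y)"
      by (simp_all add: s_def algebra_simps)
    have "2 * of_int M * \<bar>of_int q * Re (l1 (G p)) - of_int x\<bar> < 1/16"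
      "2 * of_int M * \<bar>of_int q * Re (l2 (G p)) - of_int y\<bar> < 1/16"
      unfolding N(2)[symmetric] using M xy by (intro mult_strict_left_mono; simp)+
    then have "\<bar>Re (fst (F (B p))) - of_int (M * (2 * x + 1))\<bar> < 1/16"
      "\<bar>Re (snd (F (B p))) - of_int (M * (2 * y + 1))\<bar> < 1/16"
      unfolding Re abs_mult using M by simp_all
    then have "F (B p) \<in> boxes (odd_multiples M) (1/16)"
      unfolding boxes_def odd_multiples_def by blast
    then show False using F(4) by blast
  qed
  then have "torus_proj \<Lambda> (G p) \<notin> torus_proj \<Lambda> ` V" for p
    by (auto simp: torus_proj_eq_iff[OF assms(1)] dest: V_invariant)
  moreover have "torus_proj \<Lambda> (G p) \<in> topspace (torus \<Lambda>)" for p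
    by (auto simp: topspace_torus torus_proj_def quotient_def)
  ultimately have "range (torus_proj \<Lambda> \<circ> G) \<subseteq> topspace (torus \<Lambda>) - torus_proj \<Lambda> ` V" by auto
  moreover have "Z \<subseteq> V" using q(2) by (force simp: V_def)
  then have "E \<subseteq> torus_proj \<Lambda> ` V" using Z(2) by blast
  moreover have "openin (torus \<Lambda>) (torus_proj \<Lambda> ` V)"
    using openin_torus_proj_image[OF assms(1) \<open>open V\<close>] .
  ultimately show ?thesis using dom by blast
qed

end
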